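(* Let $a,b>0$ and let $n\ge 1$ be an integer. For an integer $k\ge1$ define the plane curves $$C_{2k-1}=\Big\{\big(\cot\tfrac{\theta}{2}\cot(k\theta),\ \cot(k\theta)\cot((k-\tfrac12)\theta)\big):\ \tfrac{(2k-2)\pi}{2k-1}<\theta<\tfrac{(2k-1)\pi}{2k}\Big\},$$ $$C_{2k}=\Big\{\big(-\cot\tfrac{\theta}{2}\cot(k\theta),\ \cot(k\theta)\cot((k+\tfrac12)\theta)\big):\ \tfrac{(2k-1)\pi}{2k}<\theta<\tfrac{2k\pi}{2k+1}\Big\}.$$ Then the collision sequence $(32)^n$ is allowed as a capture process for mass ratios $(a,b)$ if and only if $(a,b)$ lies between the curves $C_{2n-1}$ (below) and $C_{2n}$ (above), boundaries included; that is, if and only if there is $b'\le b$ with $(a,b')\in C_{2n-1}$, and $b\le b''$ for every $b''$ with $(a,b'')\in C_{2n}$.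
   Context: Setting: three point particles 1, 2, 3 move in the plane, identified with $\mathbb{C}$, with masses $m_1,m_2,m_3>0$; put $a=m_1/m_2$, $b=m_3/m_2$. Between collisions particles move freely with constant velocity. A collision "$(i)$", $i\in\{1,2,3\}$, is a collision between the two particles other than $i$ (the spectator): the two particles are at the same position with nonzero relative velocity, and instantaneously their velocities change so that their total momentum is conserved and their relative velocity is multiplied by a complex number $x=e^{i\alpha}$, $|x|=1$ (so kinetic energy is conserved); the spectator's velocity is unchanged. The number $x$ (the scattering angle $\alpha$) may be any unit complex number and may be chosen independently at each collision. A collision sequence is written as a string in order of occurrence from left to right; $(32)^n$ is $(3)(2)(3)(2)\cdots(3)(2)$ with $2n$ collisions and $(2)(32)^n$ is (2) followed by $(32)^n$. The times between successive collisions are required to be strictly positive, and no other interactions occur. Capture process: initially particles 2 and 3 are at rest at distinct points, and particle 1 has a nonzero velocity. A collision sequence is allowed as a capture process for $(a,b)$ if there exist initial positions and velocity of particle 1, initial positions of 2 and 3, and scattering angles such that the collisions of the sequence occur in that order, and after the last collision particles 1 and 2 have equal velocities. Each curve $C_m$ is the graph of $b$ as a function of $a$ over an interval $0<a<A_m$ ($A_1=\infty$). *)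

theory Defs
  imports "HOL-Analysis.Analysis"
begin

datatype particle = P1 | P2 | P3

text \<open>
  A collision is named by its spectator \<open>i\<close>.  With \<open>j, k\<close> the two other particles, the condition
  below is symmetric under exchanging \<open>j\<close> and \<open>k\<close>, so the universal quantifier ranges over the two
  labellings of one and the same pair.  The scattering factor \<open>x\<close> may be \<open>1\<close>, in which case no
  velocity changes.
\<close>

definition collision ::
  "(particle \<Rightarrow> real) \<Rightarrow> particle \<Rightarrow> (particle \<Rightarrow> complex) \<Rightarrow>
   (particle \<Rightarrow> complex) \<Rightarrow> (particle \<Rightarrow> complex) \<Rightarrow> bool" where
  "collision m i q v v' \<longleftrightarrow>
     v' i = v i \<and>
     (\<exists>x::complex. cmod x = 1 \<and>
       (\<forall>j k. j \<noteq> i \<and> k \<noteq> i \<and> j \<noteq> k \<longrightarrow>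
          q j = q k \<and> v j \<noteq> v k \<and>
          of_real (m j) * v' j + of_real (m k) * v' k
            = of_real (m j) * v j + of_real (m k) * v k \<and>
          v' j - v' k = x * (v j - v k)))"

text \<open>
  \<open>run m s (q, v) (q', v')\<close>: starting from positions \<open>q\<close> and velocities \<open>v\<close>, the particles undergo
  exactly the collisions listed in \<open>s\<close>, in that order, with free motion for a positive time before
  each of them; \<open>(q', v')\<close> is the state immediately after the last one.  Velocities change only at
  the listed collisions; particles whose free paths happen to pass through a common point do not
  interact there.
\<close>

inductive run ::
  "(particle \<Rightarrow> real) \<Rightarrow> particle list \<Rightarrow>
   (particle \<Rightarrow> complex) \<times> (particle \<Rightarrow> complex) \<Rightarrow>
   (particle \<Rightarrow> complex) \<times> (particle \<Rightarrow> complex) \<Rightarrow> bool"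
  for m :: "particle \<Rightarrow> real" where
  run_Nil: "run m [] (q, v) (q, v)"
| run_Cons: "run m (i # s) (q, v) (q'', v'')"
    if "0 < t"
      and "q' = (\<lambda>j. q j + of_real t * v j)"
      and "collision m i q' v v'"
      and "run m s (q', v') (q'', v'')"
    for t :: real

definition capture_allowed :: "(particle \<Rightarrow> real) \<Rightarrow> particle list \<Rightarrow> bool" where
  "capture_allowed m s \<longleftrightarrow>
     (\<exists>q v q' v'. q P2 \<noteq> q P3 \<and> v P2 = 0 \<and> v P3 = 0 \<and> v P1 \<noteq> 0 \<and>
        run m s (q, v) (q', v') \<and> v' P1 = v' P2)"

definition seq32 :: "nat \<Rightarrow> particle list" where
  "seq32 n = concat (replicate n [P3, P2])"

text \<open>\<open>C_odd k\<close> and \<open>C_even k\<close> are the curves $C_{2k-1}$ and $C_{2k}$, for \<open>k \<ge> 1\<close>.\<close>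

definition C_odd :: "nat \<Rightarrow> (real \<times> real) set" where
  "C_odd k =
     {(cot (\<theta> / 2) * cot (real k * \<theta>), cot (real k * \<theta>) * cot ((real k - 1 / 2) * \<theta>)) | \<theta>.
        (2 * real k - 2) * pi / (2 * real k - 1) < \<theta> \<and>
        \<theta> < (2 * real k - 1) * pi / (2 * real k)}"

definition C_even :: "nat \<Rightarrow> (real \<times> real) set" where
  "C_even k =
     {(- cot (\<theta> / 2) * cot (real k * \<theta>), cot (real k * \<theta>) * cot ((real k + 1 / 2) * \<theta>)) | \<theta>.
        (2 * real k - 1) * pi / (2 * real k) < \<theta> \<and>
        \<theta> < 2 * real k * pi / (2 * real k + 1)}"

end

theory Submission
  imports Defs
begin

text \<open>
  Let \<open>u\<close> be the velocity of particle 1 relative to its next collision partner and \<open>w\<close> its velocity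
  relative to the partner just left.  A collision rotates \<open>u\<close>, and the particles can meet again
  precisely when it multiplies \<open>w\<close> by a negative number \<open>-s\<close>; this makes \<open>s\<close> a function of the Gram
  matrix of \<open>u\<close> and \<open>w\<close>, and up to exchanging the roles of \<open>u\<close> and \<open>w\<close> the angle between their lines
  is preserved.  What remains is a recursion \<open>e \<mapsto> 2 cos \<psi> - 1 / e\<close> of Chebyshev type with fixed \<open>\<psi>\<close>, so
  that \<open>(32)\<^sup>n\<close> ends in capture iff \<open>2n\<psi> < \<pi>\<close> and \<open>e\<close> starts at \<open>sin ((2n - 1)\<psi>) / sin (2n\<psi>)\<close>.
  Together with the energy balance of the first collision, this becomes
  \<open>a (1 + b) / (a + b) = (sin \<psi> / sin (2n\<psi>))\<^sup>2\<close>, and for \<open>a < 1\<close> the freedom of the first scattering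
  angle becomes \<open>\<bar>tan \<psi> cot (2n\<psi>)\<bar> \<le> a\<close>.  The two extreme cases are the curves, under
  \<open>\<theta> = \<pi> - 2\<psi>\<close>, and monotonicity of both trigonometric quotients in \<open>\<psi>\<close> gives the region between.
\<close>

section \<open>From trajectories to relative velocities\<close>

text \<open>Particle 1 takes part in every collision, so a collision with spectator \<open>i\<close>
  is a meeting of particles 1 and \<open>j\<close>. The swap at each step lets a single induction
  treat both kinds of collision.\<close>

fun alternating :: "particle \<Rightarrow> particle \<Rightarrow> nat \<Rightarrow> particle list" where
  "alternating i j 0 = []"
| "alternating i j (Suc k) = i # alternating j i k"

lemma seq32_alternating: "seq32 n = alternating P3 P2 (2 * n)"
  by (induction n) (auto simp: seq32_def)

text \<open>
  \<open>steerable p p' k u w\<close>: scattering factors exist for \<open>k + 1\<close> further alternating collisions such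
  that each meeting actually takes place and \<open>w = 0\<close> at the end.  Here \<open>p\<close> and \<open>p'\<close> are the mass
  fractions, within the pair formed with particle 1, of the next partner and of the one just left.
\<close>

fun steerable :: "real \<Rightarrow> real \<Rightarrow> nat \<Rightarrow> complex \<Rightarrow> complex \<Rightarrow> bool" where
  "steerable p p' 0 u w \<longleftrightarrow> (\<exists>x. cmod x = 1 \<and> w + of_real p * (x - 1) * u = 0)"
| "steerable p p' (Suc k) u w \<longleftrightarrow>
     (\<exists>x s. cmod x = 1 \<and> 0 < s \<and> w + of_real p * (x - 1) * u = - of_real s * w \<and>
        steerable p' p k (- of_real s * w) (x * u))"

text \<open>Momentum conservation and the rotated relative velocity form a linear system for the two
  outgoing velocities. Solving it for particle 1 brings in the mass fraction of its partner.\<close>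

lemma collision_velocity:
  assumes m: "\<And>i. m i > 0" and c: "collision m i q v v'" and ij: "i \<noteq> P1" "j \<noteq> P1" "i \<noteq> j"
  obtains x where "cmod x = 1" "q P1 = q j" "v P1 \<noteq> v j" "v' i = v i"
    "v' P1 - v' j = x * (v P1 - v j)"
    "v' P1 = v P1 + of_real (m j / (m P1 + m j)) * (x - 1) * (v P1 - v j)"
proof -
  from c ij obtain x where x: "cmod x = 1" "q P1 = q j" "v P1 \<noteq> v j" "v' i = v i"
    "v' P1 - v' j = x * (v P1 - v j)"
    and mom: "of_real (m P1) * v' P1 + of_real (m j) * v' j
            = of_real (m P1) * v P1 + of_real (m j) * v j"
    unfolding collision_def by metis
  have nz: "complex_of_real (m P1) + of_real (m j) \<noteq> 0"
    using m[of P1] m[of j] by (metis add_pos_pos less_irrefl of_real_add of_real_eq_0_iff)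
  have "v' j = v' P1 - x * (v P1 - v j)" using x(5) by (simp add: algebra_simps)
  with mom have "(of_real (m P1) + of_real (m j)) * v' P1
      = of_real (m P1) * v P1 + of_real (m j) * v j + of_real (m j) * x * (v P1 - v j)"
    by (simp add: algebra_simps)
  also have "\<dots> = (of_real (m P1) + of_real (m j)) * v P1 + of_real (m j) * (x - 1) * (v P1 - v j)"
    by (simp add: algebra_simps)
  finally have "v' P1 = v P1 + of_real (m j / (m P1 + m j)) * (x - 1) * (v P1 - v j)"
    using nz by (simp add: field_simps)
  with x that show thesis by blast
qed

lemma collisionI:
  fixes x :: complex
  assumes m: "\<And>i. m i > 0" and ij: "i \<noteq> P1" "j \<noteq> P1" "i \<noteq> j"
    and x: "cmod x = 1" and q: "q P1 = q j" and v: "v P1 \<noteq> v j"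
    and y: "y = v P1 + of_real (m j / (m P1 + m j)) * (x - 1) * (v P1 - v j)"
  shows "collision m i q v (v(P1 := y, j := y - x * (v P1 - v j)))"
proof -
  have nz: "complex_of_real (m P1) + of_real (m j) \<noteq> 0"
    using m[of P1] m[of j] by (metis add_pos_pos less_irrefl of_real_add of_real_eq_0_iff)
  have "(of_real (m P1) + of_real (m j)) * y
      = (of_real (m P1) + of_real (m j)) * v P1 + of_real (m j) * (x - 1) * (v P1 - v j)"
    using nz unfolding y by (simp add: field_simps)
  then have mom: "of_real (m P1) * y + of_real (m j) * (y - x * (v P1 - v j))
      = of_real (m P1) * v P1 + of_real (m j) * v j"
    by (simp add: algebra_simps)
  have others: "k = P1 \<and> l = j \<or> k = j \<and> l = P1" if "k \<noteq> i \<and> l \<noteq> i \<and> k \<noteq> l" for k l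
    using that ij by (cases i; cases j; cases k; cases l) auto
  show ?thesis unfolding collision_def
  proof (intro conjI exI[of _ x] allI impI)
    show "(v(P1 := y, j := y - x * (v P1 - v j))) i = v i" using ij by auto
    show "cmod x = 1" by fact
    fix k l assume "k \<noteq> i \<and> l \<noteq> i \<and> k \<noteq> l"
    from others[OF this] show "q k = q l" "v k \<noteq> v l" 
      "(v(P1 := y, j := y - x * (v P1 - v j))) k - (v(P1 := y, j := y - x * (v P1 - v j))) l
        = x * (v k - v l)"
      "of_real (m k) * (v(P1 := y, j := y - x * (v P1 - v j))) k +
       of_real (m l) * (v(P1 := y, j := y - x * (v P1 - v j))) l
       = of_real (m k) * v k + of_real (m l) * v l"
      using q v mom ij by (auto simp: algebra_simps)
  qed
qed

lemma run_ConsE: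
  assumes "run m (i # s) (q, v) (q'', v'')"
  obtains t q' v' where "0 < t" "q' = (\<lambda>j. q j + of_real t * v j)" "collision m i q' v v'"
    "run m s (q', v') (q'', v'')"
  using assms by (cases rule: run.cases) auto

lemma run_NilE:
  assumes "run m [] (q, v) (q'', v'')"
  shows "q'' = q \<and> v'' = v"
  using assms by (cases rule: run.cases) auto

text \<open>The hypothesis \<open>q P1 = q i\<close> records that particles 1 and \<open>i\<close>
  have just met; this turns their next meeting into a condition on velocities alone. The parity of
  \<open>k\<close> selects the spectator of the last collision, which is the particle captured with
  particle 1.\<close>

lemma steerable_if_run:
  assumes m: "\<And>i. m i > 0" and ij: "i \<noteq> P1" "j \<noteq> P1" "i \<noteq> j"
    and "run m (alternating i j (Suc k)) (q, v) (q'', v'')" and "q P1 = q i"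
    and "v'' P1 = v'' (if even k then i else j)"
  shows "steerable (m j / (m P1 + m j)) (m i / (m P1 + m i)) k (v P1 - v j) (v P1 - v i)"
  using assms(2-)
proof (induction k arbitrary: i j q v)
  case 0
  from 0(4) have "run m [i] (q, v) (q'', v'')" by simp
  then obtain t q' v' where c: "collision m i q' v v'" and r: "run m [] (q', v') (q'', v'')"
    by (rule run_ConsE)
  have v'': "v'' = v'" using run_NilE[OF r] by simp
  obtain x where x: "cmod x = 1" "v' i = v i"
    "v' P1 = v P1 + of_real (m j / (m P1 + m j)) * (x - 1) * (v P1 - v j)"
    by (rule collision_velocity[OF m c 0(1-3)])
  have "v' P1 - v i = 0" using 0(6) v'' x by simp
  then show ?case using x by (auto simp: algebra_simps intro!: exI[of _ x])
next
  case (Suc k)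
  from Suc.prems(4) have "run m (i # alternating j i (Suc k)) (q, v) (q'', v'')" by simp
  then obtain t q' v' where t: "0 < t" and q': "q' = (\<lambda>j. q j + of_real t * v j)"
    and c: "collision m i q' v v'" and r: "run m (alternating j i (Suc k)) (q', v') (q'', v'')"
    by (rule run_ConsE)
  obtain x where x: "cmod x = 1" "q' P1 = q' j" "v' i = v i" "v' P1 - v' j = x * (v P1 - v j)"
    "v' P1 = v P1 + of_real (m j / (m P1 + m j)) * (x - 1) * (v P1 - v j)"
    by (rule collision_velocity[OF m c Suc.prems(1-3)])
  from r have "run m (j # alternating i j k) (q', v') (q'', v'')" by simp
  then obtain t' q2 v2 where t': "0 < t'" and q2: "q2 = (\<lambda>j. q' j + of_real t' * v' j)"
    and c2: "collision m j q2 v' v2"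
    by (rule run_ConsE)
  have "q2 P1 = q2 i"
    by (rule collision_velocity[OF m c2 Suc.prems(2) Suc.prems(1) Suc.prems(3)[symmetric]])
  \<comment> \<open>Between two meetings with \<open>i\<close>, the displacement gained during time
    \<open>t\<close> at the old relative velocity is undone during time \<open>t'\<close> at the new
    one. Hence the factor \<open>- s\<close> with \<open>s = t / t'\<close>.\<close>
  then have "of_real t' * (v' P1 - v' i) = - of_real t * (v P1 - v i)"
    using Suc.prems(5) x(3) unfolding q2 q' by (simp add: algebra_simps)
  then have w: "v' P1 - v' i = - of_real (t / t') * (v P1 - v i)"
    using t' by (simp add: field_simps)
  have "steerable (m i / (m P1 + m i)) (m j / (m P1 + m j)) k (v' P1 - v' i) (v' P1 - v' j)"
    by (rule Suc.IH[OF Suc.prems(2,1) Suc.prems(3)[symmetric] r x(2)]) (use Suc.prems(6) in auto)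
  then have st: "steerable (m i / (m P1 + m i)) (m j / (m P1 + m j)) k
      (- of_real (t / t') * (v P1 - v i)) (x * (v P1 - v j))"
    using w x(4) by simp
  have "v P1 - v i + of_real (m j / (m P1 + m j)) * (x - 1) * (v P1 - v j)
      = - of_real (t / t') * (v P1 - v i)"
    using w x(3,5) by (simp add: algebra_simps)
  then show ?case
    unfolding steerable.simps using x(1) st t t'
    by (intro exI[of _ x] exI[of _ "t / t'"]) simp
qed

text \<open>Given the factors, only the times remain to be chosen. The last hypothesis schedules the
  coming meeting with \<open>j\<close> after time \<open>t\<close>, and the induction reschedules
  for \<open>i\<close>.\<close>

lemma run_if_steerable:
  assumes m: "\<And>i. m i > 0" and ij: "i \<noteq> P1" "j \<noteq> P1" "i \<noteq> j"
    and "steerable (m j / (m P1 + m j)) (m i / (m P1 + m i)) k (v P1 - v j) (v P1 - v i)"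
    and "q P1 = q i" "v P1 \<noteq> v i" "v P1 \<noteq> v j"
    and "0 < t" "q j - q P1 = of_real t * (v P1 - v j)"
  shows "\<exists>q'' v''. run m (alternating i j (Suc k)) (q, v) (q'', v'') \<and>
    v'' P1 = v'' (if even k then i else j)"
  using assms(2-)
proof (induction k arbitrary: i j q v t)
  case 0
  then obtain x where x: "cmod x = 1"
    "v P1 - v i + of_real (m j / (m P1 + m j)) * (x - 1) * (v P1 - v j) = 0" by auto
  define y where "y = v P1 + of_real (m j / (m P1 + m j)) * (x - 1) * (v P1 - v j)"
  define v' where "v' = v(P1 := y, j := y - x * (v P1 - v j))"
  define q' where "q' = (\<lambda>l. q l + of_real t * v l)"
  have q': "q' P1 = q' j" using 0(9) unfolding q'_def by (simp add: algebra_simps)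
  have "collision m i q' v v'"
    unfolding v'_def by (rule collisionI[OF m 0(1-3) x(1) q' 0(7) y_def])
  then have "run m [i] (q, v) (q', v')"
    by (rule run_Cons[OF 0(8) q'_def _ run_Nil])
  moreover have "v' P1 = v' i"
    using x(2) 0(1-3) unfolding v'_def y_def by (simp add: algebra_simps)
  ultimately show ?case by auto
next
  case (Suc k)
  from Suc.prems(4) obtain x s where x: "cmod x = 1" "0 < s"
    "v P1 - v i + of_real (m j / (m P1 + m j)) * (x - 1) * (v P1 - v j) = - of_real s * (v P1 - v i)"
    and st: "steerable (m i / (m P1 + m i)) (m j / (m P1 + m j)) k
        (- of_real s * (v P1 - v i)) (x * (v P1 - v j))" by auto
  define y where "y = v P1 + of_real (m j / (m P1 + m j)) * (x - 1) * (v P1 - v j)"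
  define v' where "v' = v(P1 := y, j := y - x * (v P1 - v j))"
  define q' where "q' = (\<lambda>l. q l + of_real t * v l)"
  have q': "q' P1 = q' j" using Suc.prems(9) unfolding q'_def by (simp add: algebra_simps)
  have c: "collision m i q' v v'"
    unfolding v'_def by (rule collisionI[OF m Suc.prems(1-3) x(1) q' Suc.prems(7) y_def])
  have u: "v' P1 - v' j = x * (v P1 - v j)" using Suc.prems(1-3) by (simp add: v'_def)
  have w: "v' P1 - v' i = - of_real s * (v P1 - v i)"
    using x(3) Suc.prems(1-3) by (simp add: v'_def y_def algebra_simps)
  have st': "steerable (m i / (m P1 + m i)) (m j / (m P1 + m j)) k (v' P1 - v' i) (v' P1 - v' j)"
    using st u w by simp
  have "\<exists>q'' v''. run m (alternating j i (Suc k)) (q', v') (q'', v'') \<and>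
      v'' P1 = v'' (if even k then j else i)"
  \<comment> \<open>The separation from \<open>i\<close> grows for time \<open>t\<close> and is then
    undone by a velocity that is \<open>s\<close> times as large and opposite, so the next meeting
    comes after time \<open>t / s\<close>.\<close>
  proof (rule Suc.IH[OF Suc.prems(2,1) Suc.prems(3)[symmetric] st' q', of "t / s"])
    have "x \<noteq> 0" using x(1) by auto
    then show "v' P1 \<noteq> v' j" using u Suc.prems(7) by auto
    show "v' P1 \<noteq> v' i" using w Suc.prems(6) x(2) by auto
    show "0 < t / s" using Suc.prems(8) x(2) by simp
    have "q' i - q' P1 = - of_real t * (v P1 - v i)"
      using Suc.prems(5) by (simp add: q'_def algebra_simps)
    then show "q' i - q' P1 = of_real (t / s) * (v' P1 - v' i)"
      unfolding w using x(2) by simp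
  qed
  then obtain q'' v'' where r: "run m (alternating j i (Suc k)) (q', v') (q'', v'')"
    and fin: "v'' P1 = v'' (if even k then j else i)" by blast
  have "run m (alternating i j (Suc (Suc k))) (q, v) (q'', v'')"
    using run_Cons[OF Suc.prems(8) q'_def c r] by simp
  moreover have "v'' P1 = v'' (if even (Suc k) then i else j)" using fin by auto
  ultimately show ?case by blast
qed

text \<open>With \<open>u = 0\<close> scattering cannot change \<open>w\<close>, although
  \<open>w\<close> would have to vanish or be multiplied by a negative number. This recovers the
  nonzero relative velocity that a collision demands.\<close>

lemma steerable_nonzero:
  assumes "steerable p p' k u w" "w \<noteq> 0"
  shows "u \<noteq> 0"
proof
  assume "u = 0"
  show False
  proof (cases k)
    case 0 then show ?thesis using assms \<open>u = 0\<close> by auto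
  next
    case (Suc k')
    then obtain s where s: "0 < s" "w = - of_real s * w" using assms \<open>u = 0\<close> by auto
    have "of_real (1 + s) * w = w - (- of_real s * w)" by (simp add: algebra_simps)
    also have "\<dots> = 0" by (simp only: s(2)[symmetric] diff_self)
    finally have "of_real (1 + s) * w = 0" .
    then have "of_real (1 + s) = (0::complex)" using assms(2) by simp
    then show ?thesis using s(1) by (simp only: of_real_eq_0_iff)
  qed
qed

text \<open>The first collision stands apart, since particles 2 and 3 start at rest. With incoming
  velocity \<open>V\<close> and factor \<open>x\<close> it gives particle 1 the velocity
  \<open>x * V\<close> relative to particle 2 and
  \<open>(1 + of_real \<alpha> * (x - 1)) * V\<close> relative to particle 3. The other
  \<open>2 * n - 1\<close> collisions have index \<open>2 * n - 2\<close>, because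
  \<open>steerable\<close> has one collision at index 0.\<close>

lemma capture_allowed_iff_steerable:
  assumes m: "\<And>i. m i > 0" and n: "n \<ge> 1"
    and \<alpha>: "\<alpha> = m P2 / (m P1 + m P2)" and \<beta>: "\<beta> = m P3 / (m P1 + m P3)"
  shows "capture_allowed m (seq32 n) \<longleftrightarrow>
    (\<exists>V x. V \<noteq> 0 \<and> cmod x = 1 \<and>
       steerable \<beta> \<alpha> (2 * n - 2) ((1 + of_real \<alpha> * (x - 1)) * V) (x * V))"
    (is "?L \<longleftrightarrow> ?R")
proof -
  have seq: "seq32 n = P3 # alternating P2 P3 (Suc (2 * n - 2))"
  proof -
    have "2 * n = Suc (Suc (2 * n - 2))" using n by simp
    then show ?thesis unfolding seq32_alternating by (metis alternating.simps(2))
  qed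
  show ?thesis
  proof
    assume ?L
    then obtain q v q'' v'' where v: "v P2 = 0" "v P3 = 0" "v P1 \<noteq> 0"
      and r: "run m (P3 # alternating P2 P3 (Suc (2 * n - 2))) (q, v) (q'', v'')"
      and fin: "v'' P1 = v'' P2"
      unfolding capture_allowed_def seq by blast
    obtain t q' v' where c: "collision m P3 q' v v'"
      and r': "run m (alternating P2 P3 (Suc (2 * n - 2))) (q', v') (q'', v'')"
      using r by (rule run_ConsE)
    obtain x where x: "cmod x = 1" "q' P1 = q' P2" "v' P3 = v P3"
      "v' P1 - v' P2 = x * (v P1 - v P2)"
      "v' P1 = v P1 + of_real (m P2 / (m P1 + m P2)) * (x - 1) * (v P1 - v P2)"
      by (rule collision_velocity[OF m c, of P2]) auto
    have "steerable (m P3 / (m P1 + m P3)) (m P2 / (m P1 + m P2)) (2 * n - 2)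
        (v' P1 - v' P3) (v' P1 - v' P2)"
      by (rule steerable_if_run[OF m _ _ _ r' x(2)]) (use fin in auto)
    moreover have "v' P1 - v' P3 = (1 + of_real \<alpha> * (x - 1)) * v P1"
      using x v \<alpha> by (simp add: algebra_simps)
    moreover have "v' P1 - v' P2 = x * v P1" using x v by simp
    ultimately have "steerable \<beta> \<alpha> (2 * n - 2) ((1 + of_real \<alpha> * (x - 1)) * v P1) (x * v P1)"
      unfolding \<alpha> \<beta> by simp
    then show ?R using v x(1) by blast
  next
    assume ?R
    then obtain V x where V: "V \<noteq> 0" and x: "cmod x = 1"
      and st: "steerable \<beta> \<alpha> (2 * n - 2) ((1 + of_real \<alpha> * (x - 1)) * V) (x * V)" by blast
    have x0: "x \<noteq> 0" using x by auto
    define u where "u = (1 + of_real \<alpha> * (x - 1)) * V"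
    have u0: "u \<noteq> 0"
      unfolding u_def by (rule steerable_nonzero[OF st]) (use V x0 in auto)
    define v where "v = (\<lambda>_. 0::complex)(P1 := V)"
    \<comment> \<open>Particle 1 reaches particle 2 at the origin at time 1 and leaves with velocity
      \<open>u\<close>. With particle 3 placed at \<open>u\<close>, the second meeting follows one
      time unit later.\<close>
    define q where "q = (\<lambda>_. 0::complex)(P1 := - V, P3 := u)"
    define q' where "q' = (\<lambda>j. q j + of_real 1 * v j)"
    define v' where "v' = v(P1 := u, P2 := u - x * (v P1 - v P2))"
    have c: "collision m P3 q' v v'"
      unfolding v'_def
      by (rule collisionI[OF m _ _ _ x]) (use V in \<open>auto simp: q'_def q_def v_def u_def \<alpha> algebra_simps\<close>)
    have "\<exists>q'' v''. run m (alternating P2 P3 (Suc (2 * n - 2))) (q', v') (q'', v'') \<and>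
       v'' P1 = v'' (if even (2 * n - 2) then P2 else P3)"
    proof (rule run_if_steerable[OF m, where t = 1])
      show "steerable (m P3 / (m P1 + m P3)) (m P2 / (m P1 + m P2)) (2 * n - 2)
          (v' P1 - v' P3) (v' P1 - v' P2)"
        using st by (simp add: v'_def v_def u_def \<alpha> \<beta>)
    qed (use V x0 u0 in \<open>auto simp: q'_def q_def v'_def v_def\<close>)
    then obtain q'' v'' where "run m (alternating P2 P3 (Suc (2 * n - 2))) (q', v') (q'', v'')"
      "v'' P1 = v'' P2" by auto
    then have "run m (seq32 n) (q, v) (q'', v'')" "v'' P1 = v'' P2"
      unfolding seq using run_Cons[OF zero_less_one q'_def c] by auto
    moreover have "q P2 \<noteq> q P3" "v P2 = 0" "v P3 = 0" "v P1 \<noteq> 0"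
      using u0 V by (auto simp: q_def v_def)
    ultimately show ?L unfolding capture_allowed_def by blast
  qed
qed

section \<open>The angle recursion\<close>

lemma cmod_diff_scaled_sq:
  "(cmod (u - of_real c * w))\<^sup>2 = (cmod u)\<^sup>2 - 2 * c * Re (u * cnj w) + c\<^sup>2 * (cmod w)\<^sup>2"
  unfolding cmod_power2 by (simp add: power2_eq_square algebra_simps)

text \<open>The velocity equation determines \<open>x * u\<close>. Then \<open>cmod x = 1\<close>
  says that subtracting \<open>(1 + s) / p\<close> times \<open>w\<close> preserves the length of
  \<open>u\<close>, a quadratic in that factor whose zero root is excluded. Allowing
  \<open>s = 0\<close> covers the final capture.\<close>

lemma scattering_iff:
  assumes "p > 0" "u \<noteq> 0" "w \<noteq> 0" "s \<ge> 0"
  shows "cmod x = 1 \<and> w + of_real p * (x - 1) * u = - of_real s * w \<longleftrightarrow>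
    x * u = u - of_real ((1 + s) / p) * w \<and> (1 + s) * (cmod w)\<^sup>2 = 2 * p * Re (u * cnj w)"
proof -
  have eq: "w + of_real p * (x - 1) * u = - of_real s * w \<longleftrightarrow> x * u = u - of_real ((1 + s) / p) * w"
  proof -
    have "w + of_real p * (x - 1) * u - (- of_real s * w)
        = of_real p * (x * u - (u - of_real ((1 + s) / p) * w))"
      using assms(1) by (simp add: field_simps)
    then show ?thesis using assms(1)
      by (metis eq_iff_diff_eq_0 less_irrefl mult_eq_0_iff of_real_eq_0_iff)
  qed
  have nrm: "cmod x = 1 \<longleftrightarrow> (1 + s) * (cmod w)\<^sup>2 = 2 * p * Re (u * cnj w)"
    if x: "x * u = u - of_real ((1 + s) / p) * w"
  proof -
    have "cmod x = 1 \<longleftrightarrow> cmod (x * u) = cmod u"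
      using assms(2) by (simp add: norm_mult)
    also have "\<dots> \<longleftrightarrow> (cmod (x * u))\<^sup>2 = (cmod u)\<^sup>2" by simp
    also have "\<dots> \<longleftrightarrow> ((1 + s) / p)\<^sup>2 * (cmod w)\<^sup>2 = 2 * ((1 + s) / p) * Re (u * cnj w)"
      unfolding x cmod_diff_scaled_sq by auto
    also have "\<dots> \<longleftrightarrow> ((1 + s) / p) * (((1 + s) / p) * (cmod w)\<^sup>2) = ((1 + s) / p) * (2 * Re (u * cnj w))"
      by (simp only: power2_eq_square mult.assoc mult.left_commute)
    also have "\<dots> \<longleftrightarrow> ((1 + s) / p) * (cmod w)\<^sup>2 = 2 * Re (u * cnj w)"
      using assms(1,4) by (subst mult_cancel_left) auto
    also have "\<dots> \<longleftrightarrow> (1 + s) * (cmod w)\<^sup>2 = 2 * p * Re (u * cnj w)"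
      using assms(1) by (simp add: field_simps)
    finally show ?thesis .
  qed
  show ?thesis using eq nrm by blast
qed

lemma steerable_0_iff:
  assumes "p > 0" "u \<noteq> 0" "w \<noteq> 0"
  shows "steerable p p' 0 u w \<longleftrightarrow> (cmod w)\<^sup>2 = 2 * p * Re (u * cnj w)"
proof -
  have "steerable p p' 0 u w \<longleftrightarrow>
      (\<exists>x. cmod x = 1 \<and> w + of_real p * (x - 1) * u = - of_real 0 * w)" by simp
  also have "\<dots> \<longleftrightarrow> (\<exists>x. x * u = u - of_real ((1 + 0) / p) * w) \<and> (cmod w)\<^sup>2 = 2 * p * Re (u * cnj w)"
    using scattering_iff[OF assms, of 0] by simp
  also have "\<dots> \<longleftrightarrow> (cmod w)\<^sup>2 = 2 * p * Re (u * cnj w)"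
    using assms(2) by (metis nonzero_divide_eq_eq)
  finally show ?thesis .
qed

lemma steerable_Suc_iff:
  assumes "p > 0" "u \<noteq> 0" "w \<noteq> 0"
  shows "steerable p p' (Suc k) u w \<longleftrightarrow>
    (\<exists>s>0. (1 + s) * (cmod w)\<^sup>2 = 2 * p * Re (u * cnj w) \<and>
       steerable p' p k (- of_real s * w) (u - of_real ((1 + s) / p) * w))" (is "?L \<longleftrightarrow> ?R")
proof
  assume ?L
  then obtain x s where x: "cmod x = 1" "0 < s" "w + of_real p * (x - 1) * u = - of_real s * w"
    "steerable p' p k (- of_real s * w) (x * u)" by auto
  then show ?R using scattering_iff[OF assms, of s x] by auto
next
  assume ?R
  then obtain s where s: "s > 0" "(1 + s) * (cmod w)\<^sup>2 = 2 * p * Re (u * cnj w)"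
    "steerable p' p k (- of_real s * w) (u - of_real ((1 + s) / p) * w)" by blast
  obtain x where x: "x * u = u - of_real ((1 + s) / p) * w"
    using assms(2) by (metis nonzero_divide_eq_eq)
  then have "cmod x = 1 \<and> w + of_real p * (x - 1) * u = - of_real s * w"
    using scattering_iff[OF assms, of s x] s by auto
  then show ?L using s x unfolding steerable.simps by metis
qed

lemma steerable_Re_pos:
  assumes "p > 0" "u \<noteq> 0" "w \<noteq> 0" "steerable p p' k u w"
  shows "Re (u * cnj w) > 0"
proof -
  have "\<exists>s\<ge>0. (1 + s) * (cmod w)\<^sup>2 = 2 * p * Re (u * cnj w)"
  proof (cases k)
    case 0
    then show ?thesis using steerable_0_iff[OF assms(1-3)] assms(4) by (intro exI[of _ 0]) auto
  next
    case (Suc k')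
    then show ?thesis using steerable_Suc_iff[OF assms(1-3)] assms(4) less_imp_le by blast
  qed
  then obtain s where "s \<ge> 0" "(1 + s) * (cmod w)\<^sup>2 = 2 * p * Re (u * cnj w)" by blast
  moreover have "(1 + s) * (cmod w)\<^sup>2 > 0" using \<open>s \<ge> 0\<close> assms(3) by simp
  ultimately show ?thesis using assms(1) by (simp add: zero_less_mult_iff)
qed

text \<open>The Chebyshev recursion that drives the induction on collisions.\<close>

lemma sin_add_two_multiples: "sin ((x + 2) * \<psi>) = 2 * cos \<psi> * sin ((x + 1) * \<psi>) - sin (x * \<psi>)"
  for x :: real
proof -
  have "sin ((x + 2) * \<psi>) = sin ((x + 1) * \<psi> + \<psi>)" "sin (x * \<psi>) = sin ((x + 1) * \<psi> - \<psi>)"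
    by (simp_all add: algebra_simps)
  then show ?thesis unfolding sin_add sin_diff by simp
qed

text \<open>The hypothesis on \<open>cos \<psi>\<close> is invariant: a collision multiplies
  \<open>Re (u * cnj w)\<close> by \<open>s\<close>, exchanges the two lengths up to the same
  factor, and exchanges \<open>p\<close> with \<open>p'\<close>. For
  \<open>e = p * Re (u * cnj w) / ((cmod w)\<^sup>2 * cos \<psi>)\<close> the meeting condition
  reads \<open>s = 2 * e * cos \<psi> - 1\<close>, and the next value of \<open>e\<close> is
  \<open>s / e\<close>. The quotients of consecutive sines follow this recursion down to
  \<open>1 / (2 * cos \<psi>)\<close> at \<open>k = 0\<close>, and the bound by \<open>pi\<close>
  keeps every \<open>s\<close> positive.\<close>

lemma steerable_iff_angle:
  assumes "p > 0" "p' > 0" "u \<noteq> 0" "w \<noteq> 0" "0 < \<psi>" "\<psi> < pi / 2"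
    and "(cos \<psi>)\<^sup>2 * ((cmod u)\<^sup>2 * (cmod w)\<^sup>2) = p * p' * (Re (u * cnj w))\<^sup>2"
  shows "steerable p p' k u w \<longleftrightarrow> Re (u * cnj w) > 0 \<and> (real k + 2) * \<psi> < pi \<and>
    p * Re (u * cnj w) * sin ((real k + 2) * \<psi>) = (cmod w)\<^sup>2 * cos \<psi> * sin ((real k + 1) * \<psi>)"
  using assms
proof (induction k arbitrary: p p' u w)
  case 0
  have c: "cos \<psi> > 0" "sin \<psi> > 0" using 0 by (auto intro: cos_gt_zero sin_gt_zero)
  have w: "(cmod w)\<^sup>2 > 0" using 0 by simp
  have s2: "sin (2 * \<psi>) = 2 * sin \<psi> * cos \<psi>" by (rule sin_double)
  have "p * Re (u * cnj w) * sin (2 * \<psi>) = (cmod w)\<^sup>2 * cos \<psi> * sin \<psi> \<longleftrightarrow>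
      (cos \<psi> * sin \<psi>) * (2 * p * Re (u * cnj w)) = (cos \<psi> * sin \<psi>) * (cmod w)\<^sup>2"
    unfolding s2 by (simp add: algebra_simps)
  also have "\<dots> \<longleftrightarrow> (cmod w)\<^sup>2 = 2 * p * Re (u * cnj w)"
    using c by (subst mult_cancel_left) auto
  finally have "p * Re (u * cnj w) * sin (2 * \<psi>) = (cmod w)\<^sup>2 * cos \<psi> * sin \<psi> \<longleftrightarrow>
      steerable p p' 0 u w" unfolding steerable_0_iff[OF 0(1,3,4)] .
  moreover have "Re (u * cnj w) > 0" if "steerable p p' 0 u w"
    using steerable_Re_pos[OF 0(1,3,4) that] .
  ultimately show ?case using 0(6) by (auto simp: algebra_simps)
next
  case (Suc k)
  note pos = Suc.prems(1,2) and nz = Suc.prems(3,4) and psi = Suc.prems(5,6) and ang = Suc.prems(7)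
  define D where "D = Re (u * cnj w)"
  define A where "A = (cmod w)\<^sup>2"
  define B where "B = (cmod u)\<^sup>2"
  define S where "S l = sin ((real k + l) * \<psi>)" for l
  have AB: "A > 0" "B > 0" using nz by (auto simp: A_def B_def)
  have c: "cos \<psi> > 0" using psi by (auto intro: cos_gt_zero)
  have ang': "(cos \<psi>)\<^sup>2 * (B * A) = p * p' * D\<^sup>2" using ang by (simp add: A_def B_def D_def)
  have rec: "S 3 = 2 * cos \<psi> * S 2 - S 1"
    using sin_add_two_multiples[of "real k + 1" \<psi>] by (simp add: S_def add.commute)
  \<comment> \<open>Multiplication by \<open>p * D * A\<close> lets the invariant
    \<open>ang'\<close> replace \<open>p * p' * D\<^sup>2\<close>; afterwards
    \<open>cos \<psi> * A * B\<close> cancels.\<close>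
  have key: "p' * (s * D) * S 2 = B * cos \<psi> * S 1 \<longleftrightarrow> p * D * S 3 = A * cos \<psi> * S 2"
    if s: "(1 + s) * A = 2 * p * D" "D > 0" for s
  proof -
    have "p' * (s * D) * S 2 = B * cos \<psi> * S 1 \<longleftrightarrow>
        p * D * A * (p' * (s * D) * S 2) = p * D * A * (B * cos \<psi> * S 1)"
      using that pos AB by simp
    also have "p * D * A * (p' * (s * D) * S 2) = (p * p' * D\<^sup>2) * (s * A * S 2)"
      by (simp add: power2_eq_square algebra_simps)
    also have "\<dots> = (cos \<psi> * A * B) * (cos \<psi> * (s * A) * S 2)"
      unfolding ang'[symmetric] by (simp add: power2_eq_square algebra_simps)
    also have "p * D * A * (B * cos \<psi> * S 1) = (cos \<psi> * A * B) * (p * D * S 1)" by simp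
    also have "(cos \<psi> * A * B) * (cos \<psi> * (s * A) * S 2) = (cos \<psi> * A * B) * (p * D * S 1) \<longleftrightarrow>
        cos \<psi> * (s * A) * S 2 = p * D * S 1" using c AB by simp
    also have "s * A = 2 * p * D - A" using s by (simp add: algebra_simps)
    also have "cos \<psi> * (2 * p * D - A) * S 2 = p * D * S 1 \<longleftrightarrow> p * D * S 3 = A * cos \<psi> * S 2"
      unfolding rec by (auto simp: algebra_simps)
    finally show ?thesis .
  qed
  have step: "steerable p' p k (- of_real s * w) (u - of_real ((1 + s) / p) * w) \<longleftrightarrow>
      D > 0 \<and> (real k + 2) * \<psi> < pi \<and> p' * (s * D) * S 2 = B * cos \<psi> * S 1"
    if s: "s > 0" "(1 + s) * A = 2 * p * D" for s
  proof -
    define u' where "u' = u - of_real ((1 + s) / p) * w"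
    have "(cmod u')\<^sup>2 = B - 2 * ((1 + s) / p) * D + ((1 + s) / p)\<^sup>2 * A"
      unfolding u'_def cmod_diff_scaled_sq by (simp add: A_def B_def D_def)
    also have "((1 + s) / p)\<^sup>2 * A = ((1 + s) / p) * ((1 + s) * A) / p"
      by (simp add: power2_eq_square)
    also have "\<dots> = 2 * ((1 + s) / p) * D" unfolding s(2) using pos by simp
    finally have u': "(cmod u')\<^sup>2 = B" by simp
    have "(cmod (- of_real s * w))\<^sup>2 = s\<^sup>2 * A"
      by (simp add: norm_mult power_mult_distrib A_def)
    have "Re (- of_real s * w * cnj (u - of_real c * w)) = - s * D + s * c * A" for c
      unfolding D_def A_def cmod_power2 by (simp add: algebra_simps power2_eq_square)
    from this[of "(1 + s) / p"]
    have "Re (- of_real s * w * cnj u') = - s * D + s * ((1 + s) / p) * A"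
      unfolding u'_def .
    also have "s * ((1 + s) / p) * A = s * ((1 + s) * A) / p" by simp
    also have "\<dots> = 2 * s * D" unfolding s(2) using pos by simp
    finally have D': "Re (- of_real s * w * cnj u') = s * D" by simp
    have "u' \<noteq> 0" using u' AB by auto
    moreover have "- of_real s * w \<noteq> 0" using s nz by simp
    moreover have "(cos \<psi>)\<^sup>2 * ((cmod (- of_real s * w))\<^sup>2 * (cmod u')\<^sup>2)
        = p' * p * (Re (- of_real s * w * cnj u'))\<^sup>2"
      unfolding D' u' \<open>(cmod (- of_real s * w))\<^sup>2 = s\<^sup>2 * A\<close> power_mult_distrib
      using ang' by (simp add: algebra_simps)
    ultimately have "steerable p' p k (- of_real s * w) u' \<longleftrightarrow> s * D > 0 \<and> (real k + 2) * \<psi> < pi \<and>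
        p' * (s * D) * S 2 = B * cos \<psi> * S 1"
      using Suc.IH[of p' p "- of_real s * w" u'] pos psi unfolding D' u' S_def by simp
    then show ?thesis using s(1) unfolding u'_def by (simp add: zero_less_mult_iff)
  qed
  have "steerable p p' (Suc k) u w \<longleftrightarrow> (\<exists>s>0. (1 + s) * A = 2 * p * D \<and>
      D > 0 \<and> (real k + 2) * \<psi> < pi \<and> p' * (s * D) * S 2 = B * cos \<psi> * S 1)"
    unfolding steerable_Suc_iff[OF pos(1) nz] A_def[symmetric] D_def[symmetric] using step by blast
  also have "\<dots> \<longleftrightarrow> D > 0 \<and> (real k + 3) * \<psi> < pi \<and> p * D * S 3 = A * cos \<psi> * S 2"
    (is "?L \<longleftrightarrow> ?R")
  proof
    assume ?L
    then obtain s where s: "s > 0" "(1 + s) * A = 2 * p * D" "D > 0" "(real k + 2) * \<psi> < pi"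
      "p' * (s * D) * S 2 = B * cos \<psi> * S 1" by blast
    have eq: "p * D * S 3 = A * cos \<psi> * S 2" using key[OF s(2,3)] s(5) by blast
    have "S 2 > 0" unfolding S_def using psi s(4) by (intro sin_gt_zero) auto
    then have "p * D * S 3 > 0" unfolding eq using AB c by simp
    then have "S 3 > 0" using mult_pos_pos[OF pos(1) s(3)] by (simp only: zero_less_mult_pos)
    \<comment> \<open>Positivity of \<open>S 3\<close> alone would allow angles beyond a full turn.
      The bound on the previous multiple and \<open>\<psi> < pi / 2\<close> exclude them.\<close>
    have "(real k + 3) * \<psi> < pi"
    proof (rule ccontr)
      assume "\<not> ?thesis"
      moreover have "(real k + 3) * \<psi> < 2 * pi"
        using s(4) psi pi_gt_zero by (simp add: algebra_simps)
      ultimately have "S 3 \<le> 0" unfolding S_def by (intro sin_le_zero) auto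
      then show False using \<open>S 3 > 0\<close> by simp
    qed
    then show ?R using eq s by blast
  next
    assume R: ?R
    \<comment> \<open>The meeting condition leaves no other choice of \<open>s\<close>. Its sign is
      read off from \<open>key\<close>, as \<open>S 1\<close> and \<open>S 2\<close> are
      positive.\<close>
    define s where "s = 2 * p * D / A - 1"
    have s: "(1 + s) * A = 2 * p * D" using AB by (simp add: s_def)
    have less: "(real k + 2) * \<psi> < pi" "(real k + 1) * \<psi> < pi" using R psi by (simp_all add: algebra_simps)
    have S: "S 2 > 0" "S 1 > 0" unfolding S_def using psi less by (auto intro!: sin_gt_zero)
    have eq: "p' * (s * D) * S 2 = B * cos \<psi> * S 1" using key[OF s] R by blast
    also have "\<dots> > 0" using AB c S by simp
    finally have "0 < (p' * D * S 2) * s" by (simp only: mult.assoc mult.left_commute mult.commute)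
    moreover have "0 < p' * D * S 2" using pos S R by simp
    ultimately have "s > 0" by (rule zero_less_mult_pos)
    then show ?L using s R less eq by blast
  qed
  finally show ?case unfolding D_def A_def S_def by (simp add: add.commute add.left_commute)
qed

section \<open>The first collision and its free scattering angle\<close>

text \<open>The Gram matrix of the two relative velocities depends on \<open>x\<close> only through
  \<open>\<alpha> + (1 - \<alpha>) * Re x\<close>, called \<open>d\<close> below. This number is the
  single freedom left by the first collision.\<close>

lemma first_collision_gram:
  fixes V x :: complex and \<alpha> :: real
  assumes "cmod x = 1"
  shows "Re ((1 + of_real \<alpha> * (x - 1)) * V * cnj (x * V)) = (cmod V)\<^sup>2 * (\<alpha> + (1 - \<alpha>) * Re x)"
    and "(cmod ((1 + of_real \<alpha> * (x - 1)) * V))\<^sup>2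
      = (cmod V)\<^sup>2 * (1 - 2 * \<alpha> + 2 * \<alpha> * (\<alpha> + (1 - \<alpha>) * Re x))"
proof -
  have x: "(Re x)\<^sup>2 + (Im x)\<^sup>2 = 1" using assms by (metis cmod_power2 one_power2)
  have "(1 + of_real \<alpha> * (x - 1)) * V * cnj (x * V)
      = of_real ((cmod V)\<^sup>2) * ((1 + of_real \<alpha> * (x - 1)) * cnj x)"
    by (simp only: complex_norm_square complex_cnj_mult mult.assoc mult.commute mult.left_commute)
  then have "Re ((1 + of_real \<alpha> * (x - 1)) * V * cnj (x * V))
      = (cmod V)\<^sup>2 * Re ((1 + of_real \<alpha> * (x - 1)) * cnj x)"
    by (simp only: times_complex.sel Re_complex_of_real Im_complex_of_real mult_zero_left diff_zero)
  also have "Re ((1 + of_real \<alpha> * (x - 1)) * cnj x)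
      = (1 - \<alpha>) * Re x + \<alpha> * ((Re x)\<^sup>2 + (Im x)\<^sup>2)"
    by (simp add: algebra_simps power2_eq_square)
  finally show "Re ((1 + of_real \<alpha> * (x - 1)) * V * cnj (x * V))
      = (cmod V)\<^sup>2 * (\<alpha> + (1 - \<alpha>) * Re x)" unfolding x by simp
  have "(cmod (1 + of_real \<alpha> * (x - 1)))\<^sup>2
      = (1 - \<alpha>)\<^sup>2 + 2 * \<alpha> * (1 - \<alpha>) * Re x + \<alpha>\<^sup>2 * ((Re x)\<^sup>2 + (Im x)\<^sup>2)"
    unfolding cmod_power2 by (simp add: algebra_simps power2_eq_square)
  also have "\<dots> = 1 - 2 * \<alpha> + 2 * \<alpha> * (\<alpha> + (1 - \<alpha>) * Re x)"
    unfolding x by (simp add: algebra_simps power2_eq_square)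
  finally show "(cmod ((1 + of_real \<alpha> * (x - 1)) * V))\<^sup>2
      = (cmod V)\<^sup>2 * (1 - 2 * \<alpha> + 2 * \<alpha> * (\<alpha> + (1 - \<alpha>) * Re x))"
    by (simp add: norm_mult power_mult_distrib)
qed

text \<open>Behind this is the law of cosines in a triangle with angles \<open>\<psi>\<close>,
  \<open>(N - 1) * \<psi>\<close> and \<open>pi - N * \<psi>\<close>, scaled so that the side
  opposite the last angle is 1. By the law of sines the other sides are
  \<open>sin \<psi> / sin (N * \<psi>)\<close> and \<open>G\<close>.\<close>

lemma sin_ratio_quadratic:
  assumes "sin (N * \<psi>) \<noteq> (0::real)"
  defines "G \<equiv> sin ((N - 1) * \<psi>) / sin (N * \<psi>)"
  shows "G\<^sup>2 - 2 * cos \<psi> * G = (sin \<psi> / sin (N * \<psi>))\<^sup>2 - 1"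
proof -
  define sN where "sN = sin (N * \<psi>)"
  define cN where "cN = cos (N * \<psi>)"
  have "(N - 1) * \<psi> = N * \<psi> - \<psi>" by (simp add: algebra_simps)
  then have s1: "sin ((N - 1) * \<psi>) = sN * cos \<psi> - cN * sin \<psi>"
    by (simp add: sin_diff sN_def cN_def)
  have pyth: "sN\<^sup>2 = 1 - cN\<^sup>2" "(cos \<psi>)\<^sup>2 = 1 - (sin \<psi>)\<^sup>2"
    unfolding sN_def cN_def by (rule sin_squared_eq, rule cos_squared_eq)
  have "(sin ((N - 1) * \<psi>))\<^sup>2 - 2 * cos \<psi> * sin ((N - 1) * \<psi>) * sN
      = cN\<^sup>2 * (sin \<psi>)\<^sup>2 - sN\<^sup>2 * (cos \<psi>)\<^sup>2"
    unfolding s1 by (simp add: power2_eq_square algebra_simps)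
  also have "\<dots> = (sin \<psi>)\<^sup>2 - sN\<^sup>2" unfolding pyth by (simp add: algebra_simps)
  finally have "(sin ((N - 1) * \<psi>))\<^sup>2 - 2 * cos \<psi> * sin ((N - 1) * \<psi>) * sN = (sin \<psi>)\<^sup>2 - sN\<^sup>2" .
  then have "((sin ((N - 1) * \<psi>))\<^sup>2 - 2 * cos \<psi> * sin ((N - 1) * \<psi>) * sN) / sN\<^sup>2
      = ((sin \<psi>)\<^sup>2 - sN\<^sup>2) / sN\<^sup>2" by simp
  then show ?thesis using assms(1) unfolding G_def sN_def[symmetric]
    by (simp add: diff_divide_distrib power_divide power2_eq_square)
qed

text \<open>Elimination of \<open>d\<close>: the angle criterion fixes \<open>\<beta> * d\<close>,
  and inserting this value into the relation that defines \<open>\<psi>\<close> gives the equation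
  for the squared sine quotient. The two inequalities express
  \<open>2 * \<alpha> - 1 \<le> d \<le> 1\<close>, that is, \<open>Re x\<close> between -1 and
  1.\<close>

lemma steerable_after_first_iff:
  assumes \<alpha>: "0 < \<alpha>" "\<alpha> < 1" and \<beta>: "0 < \<beta>" "\<beta> < 1" and n: "n \<ge> 1"
  defines "N \<equiv> 2 * real n"
  shows "(\<exists>V x. V \<noteq> 0 \<and> cmod x = 1 \<and>
       steerable \<beta> \<alpha> (2 * n - 2) ((1 + of_real \<alpha> * (x - 1)) * V) (x * V)) \<longleftrightarrow>
    (\<exists>\<psi>. 0 < \<psi> \<and> N * \<psi> < pi \<and>
       (sin \<psi> / sin (N * \<psi>))\<^sup>2 = 1 - (2 * \<alpha> - 1) * \<beta> / \<alpha> \<and>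
       (2 * \<alpha> - 1) * \<beta> \<le> cos \<psi> * sin ((N - 1) * \<psi>) / sin (N * \<psi>) \<and>
       cos \<psi> * sin ((N - 1) * \<psi>) / sin (N * \<psi>) \<le> \<beta>)" (is "?L \<longleftrightarrow> ?R")
proof -
  have N: "real (2 * n - 2) + 2 = N" "real (2 * n - 2) + 1 = N - 1" "N \<ge> 2"
    using n by (auto simp: N_def of_nat_diff)
  have energy: "(cos \<psi>)\<^sup>2 * (1 - 2 * \<alpha> + 2 * \<alpha> * d) = \<beta> * \<alpha> * d\<^sup>2 \<longleftrightarrow>
      (sin \<psi> / sin (N * \<psi>))\<^sup>2 = 1 - (2 * \<alpha> - 1) * \<beta> / \<alpha>"
    if s: "sin (N * \<psi>) \<noteq> 0" "cos \<psi> \<noteq> 0" and d: "\<beta> * d = cos \<psi> * sin ((N - 1) * \<psi>) / sin (N * \<psi>)"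
    for \<psi> d
  proof -
    define G where "G = sin ((N - 1) * \<psi>) / sin (N * \<psi>)"
    have dG: "d = cos \<psi> * G / \<beta>" using d \<beta> unfolding G_def by (metis less_irrefl nonzero_mult_div_cancel_left times_divide_eq_right)
    have "(cos \<psi>)\<^sup>2 * (1 - 2 * \<alpha> + 2 * \<alpha> * d) - \<beta> * \<alpha> * d\<^sup>2 =
        - ((cos \<psi>)\<^sup>2 * \<alpha> / \<beta>) * ((G\<^sup>2 - 2 * cos \<psi> * G) + (2 * \<alpha> - 1) * \<beta> / \<alpha>)"
      using \<alpha> \<beta> unfolding dG by (simp add: field_simps power2_eq_square)
    moreover have "(cos \<psi>)\<^sup>2 * \<alpha> / \<beta> \<noteq> 0" using s \<alpha> \<beta> by simp
    ultimately have "(cos \<psi>)\<^sup>2 * (1 - 2 * \<alpha> + 2 * \<alpha> * d) - \<beta> * \<alpha> * d\<^sup>2 = 0 \<longleftrightarrow>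
        (G\<^sup>2 - 2 * cos \<psi> * G) + (2 * \<alpha> - 1) * \<beta> / \<alpha> = 0"
      by (metis mult_eq_0_iff neg_equal_0_iff_equal)
    then show ?thesis unfolding G_def sin_ratio_quadratic[OF s(1)] by linarith
  qed
  have steer: "steerable \<beta> \<alpha> (2 * n - 2) ((1 + of_real \<alpha> * (x - 1)) * V) (x * V) \<longleftrightarrow>
      0 < d \<and> N * \<psi> < pi \<and> \<beta> * d = cos \<psi> * sin ((N - 1) * \<psi>) / sin (N * \<psi>)"
    if V: "V \<noteq> 0" "cmod x = 1" and d: "d = \<alpha> + (1 - \<alpha>) * Re x"
      and u: "(1 + of_real \<alpha> * (x - 1)) * V \<noteq> 0"
      and \<psi>: "0 < \<psi>" "\<psi> < pi / 2"
      and ang: "(cos \<psi>)\<^sup>2 * (1 - 2 * \<alpha> + 2 * \<alpha> * d) = \<beta> * \<alpha> * d\<^sup>2"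
    for V x d \<psi>
  proof -
    let ?u = "(1 + of_real \<alpha> * (x - 1)) * V" and ?A = "(cmod V)\<^sup>2"
    have A: "?A > 0" using V by simp
    have w: "(cmod (x * V))\<^sup>2 = ?A" using V by (simp add: norm_mult)
    have "x * V \<noteq> 0" using V by auto
    have D: "Re (?u * cnj (x * V)) = ?A * d" using first_collision_gram(1)[OF V(2)] d by simp
    have u2: "(cmod ?u)\<^sup>2 = ?A * (1 - 2 * \<alpha> + 2 * \<alpha> * d)"
      using first_collision_gram(2)[OF V(2)] d by simp
    have "(cos \<psi>)\<^sup>2 * ((cmod ?u)\<^sup>2 * (cmod (x * V))\<^sup>2)
        = ((cos \<psi>)\<^sup>2 * (1 - 2 * \<alpha> + 2 * \<alpha> * d)) * ?A\<^sup>2"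
      unfolding w u2 by (simp add: power2_eq_square algebra_simps)
    also have "\<dots> = \<beta> * \<alpha> * (Re (?u * cnj (x * V)))\<^sup>2"
      unfolding D ang by (simp add: power2_eq_square algebra_simps)
    finally have "steerable \<beta> \<alpha> (2 * n - 2) ?u (x * V) \<longleftrightarrow> ?A * d > 0 \<and> N * \<psi> < pi \<and>
        \<beta> * (?A * d) * sin (N * \<psi>) = ?A * cos \<psi> * sin ((N - 1) * \<psi>)"
      using steerable_iff_angle[OF \<beta>(1) \<alpha>(1) u \<open>x * V \<noteq> 0\<close> \<psi>, of "2 * n - 2"]
      unfolding N D w by blast
    also have "\<beta> * (?A * d) * sin (N * \<psi>) = ?A * cos \<psi> * sin ((N - 1) * \<psi>) \<longleftrightarrow>
        ?A * (\<beta> * d * sin (N * \<psi>)) = ?A * (cos \<psi> * sin ((N - 1) * \<psi>))"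
      by (simp add: algebra_simps)
    also have "\<dots> \<longleftrightarrow> \<beta> * d * sin (N * \<psi>) = cos \<psi> * sin ((N - 1) * \<psi>)" using A by simp
    also have "?A * d > 0 \<longleftrightarrow> d > 0" using A by (simp add: zero_less_mult_iff)
    also have "0 < d \<and> N * \<psi> < pi \<and> \<beta> * d * sin (N * \<psi>) = cos \<psi> * sin ((N - 1) * \<psi>) \<longleftrightarrow>
        0 < d \<and> N * \<psi> < pi \<and> \<beta> * d = cos \<psi> * sin ((N - 1) * \<psi>) / sin (N * \<psi>)"
    proof -
      have "sin (N * \<psi>) > 0" if "N * \<psi> < pi" using that \<psi> N by (intro sin_gt_zero) auto
      then show ?thesis by (auto simp: field_simps)
    qed
    finally show ?thesis .
  qed
  show ?thesis
  proof
    assume ?L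
    then obtain V x where V: "V \<noteq> 0" "cmod x = 1"
      and st: "steerable \<beta> \<alpha> (2 * n - 2) ((1 + of_real \<alpha> * (x - 1)) * V) (x * V)" by blast
    let ?u = "(1 + of_real \<alpha> * (x - 1)) * V" and ?A = "(cmod V)\<^sup>2"
    define d where "d = \<alpha> + (1 - \<alpha>) * Re x"
    define B where "B = 1 - 2 * \<alpha> + 2 * \<alpha> * d"
    have "x * V \<noteq> 0" using V by auto
    note u = steerable_nonzero[OF st this]
    have A: "?A > 0" using V by simp
    have D: "Re (?u * cnj (x * V)) = ?A * d" using first_collision_gram(1)[OF V(2)] d_def by simp
    have u2: "(cmod ?u)\<^sup>2 = ?A * B"
      using first_collision_gram(2)[OF V(2)] d_def B_def by simp
    have "?A * d > 0" using steerable_Re_pos[OF \<beta>(1) u \<open>x * V \<noteq> 0\<close> st] D by simp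
    then have d0: "d > 0" using A by (simp add: zero_less_mult_iff)
    have "?A * B > 0" using u u2 by (metis zero_less_norm_iff zero_less_power)
    then have B0: "B > 0" using A by (simp add: zero_less_mult_iff)
    \<comment> \<open>Cauchy-Schwarz. Together with \<open>\<beta> * \<alpha> < 1\<close> it makes
      the number \<open>c\<close> below the cosine of an angle strictly between 0 and
      \<open>pi / 2\<close>.\<close>
    have "(?A * d)\<^sup>2 \<le> (cmod (?u * cnj (x * V)))\<^sup>2"
      unfolding D[symmetric] by (rule abs_le_square_iff[THEN iffD1]) (simp only: abs_norm_cancel abs_Re_le_cmod)
    also have "\<dots> = ?A * (?A * B)" using u2 V by (simp add: norm_mult power_mult_distrib)
    finally have "?A\<^sup>2 * d\<^sup>2 \<le> ?A\<^sup>2 * B" by (simp add: power2_eq_square mult.assoc mult.left_commute)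
    then have dB: "d\<^sup>2 \<le> B" using A by simp
    define c where "c = sqrt (\<beta> * \<alpha> * d\<^sup>2 / B)"
    have c0: "c > 0" using \<alpha> \<beta> d0 B0 by (simp add: c_def)
    have "\<beta> * \<alpha> < 1 * 1" using \<alpha> \<beta> by (intro mult_strict_mono) auto
    then have "\<beta> * \<alpha> * d\<^sup>2 < 1 * d\<^sup>2" using d0 by (intro mult_strict_right_mono) auto
    then have "\<beta> * \<alpha> * d\<^sup>2 / B < 1" using dB B0 by simp
    then have c1: "c < 1" by (simp add: c_def)
    have c2: "c\<^sup>2 = \<beta> * \<alpha> * d\<^sup>2 / B" using \<alpha> \<beta> B0 by (simp add: c_def)
    define \<psi> where "\<psi> = arccos c"
    have cos: "cos \<psi> = c" using c0 c1 by (simp add: \<psi>_def)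
    have \<psi>: "0 < \<psi>" "\<psi> < pi / 2"
      using arccos_lt_bounded[of c] arccos_less_mono[of c 0] c0 c1 by (auto simp: \<psi>_def)
    have ang: "(cos \<psi>)\<^sup>2 * (1 - 2 * \<alpha> + 2 * \<alpha> * d) = \<beta> * \<alpha> * d\<^sup>2"
      using c2 B0 by (simp add: cos B_def[symmetric])
    have F: "N * \<psi> < pi" "\<beta> * d = cos \<psi> * sin ((N - 1) * \<psi>) / sin (N * \<psi>)"
      using steer[OF V d_def u \<psi> ang] st by auto
    have "sin (N * \<psi>) > 0" using F \<psi> N by (intro sin_gt_zero) auto
    then have E: "(sin \<psi> / sin (N * \<psi>))\<^sup>2 = 1 - (2 * \<alpha> - 1) * \<beta> / \<alpha>"
      using energy[OF _ _ F(2)] ang c0 cos by simp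
    have "\<bar>Re x\<bar> \<le> 1" using abs_Re_le_cmod[of x] V by simp
    then have "(1 - \<alpha>) * Re x \<le> (1 - \<alpha>) * 1" "(1 - \<alpha>) * (- 1) \<le> (1 - \<alpha>) * Re x"
      using \<alpha> by (intro mult_left_mono; auto)+
    then have d: "d \<le> 1" "2 * \<alpha> - 1 \<le> d" by (simp_all add: d_def)
    have "(2 * \<alpha> - 1) * \<beta> \<le> d * \<beta>" "d * \<beta> \<le> 1 * \<beta>"
      using d \<beta> by (intro mult_right_mono; simp)+
    then show ?R using \<psi> F E by (auto simp: mult.commute intro!: exI[of _ \<psi>])
  next
    assume ?R
    then obtain \<psi> where \<psi>: "0 < \<psi>" "N * \<psi> < pi"
      and E: "(sin \<psi> / sin (N * \<psi>))\<^sup>2 = 1 - (2 * \<alpha> - 1) * \<beta> / \<alpha>"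
      and F: "(2 * \<alpha> - 1) * \<beta> \<le> cos \<psi> * sin ((N - 1) * \<psi>) / sin (N * \<psi>)"
        "cos \<psi> * sin ((N - 1) * \<psi>) / sin (N * \<psi>) \<le> \<beta>" by blast
    have "2 * \<psi> \<le> N * \<psi>" using N \<psi> by (intro mult_right_mono) auto
    then have \<psi>2: "\<psi> < pi / 2" using \<psi> by linarith
    define d where "d = cos \<psi> * sin ((N - 1) * \<psi>) / sin (N * \<psi>) / \<beta>"
    have \<beta>d: "\<beta> * d = cos \<psi> * sin ((N - 1) * \<psi>) / sin (N * \<psi>)" using \<beta> by (simp add: d_def)
    have d: "2 * \<alpha> - 1 \<le> d" "d \<le> 1" using F \<beta>
      unfolding \<beta>d[symmetric] by (simp_all add: mult.commute[of _ \<beta>])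
    have sN: "sin (N * \<psi>) > 0" using \<psi> N by (intro sin_gt_zero) auto
    have s1: "sin ((N - 1) * \<psi>) > 0" using \<psi> N by (intro sin_gt_zero) (auto simp: algebra_simps)
    have cpos: "cos \<psi> > 0" using \<psi> \<psi>2 by (intro cos_gt_zero) auto
    have d0: "d > 0" using sN s1 cpos \<beta> by (simp add: d_def)
    have ang: "(cos \<psi>)\<^sup>2 * (1 - 2 * \<alpha> + 2 * \<alpha> * d) = \<beta> * \<alpha> * d\<^sup>2"
      using energy[OF _ _ \<beta>d] E sN cpos by simp
    \<comment> \<open>The real part that \<open>d\<close> prescribes for the first scattering
      factor. The sign of the imaginary part is arbitrary.\<close>
    define r where "r = (d - \<alpha>) / (1 - \<alpha>)"
    have r: "- 1 \<le> r" "r \<le> 1" using d \<alpha> by (simp_all add: r_def field_simps)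
    then have r2: "r\<^sup>2 \<le> 1" by (simp add: abs_square_le_1)
    define x where "x = Complex r (sqrt (1 - r\<^sup>2))"
    have x: "cmod x = 1" using r2 by (simp add: x_def cmod_def)
    have dx: "d = \<alpha> + (1 - \<alpha>) * Re x" using \<alpha> by (simp add: x_def r_def)
    \<comment> \<open>If the outgoing velocity vanished, the left side of \<open>ang\<close> would
      be zero against a positive right side.\<close>
    have "\<beta> * \<alpha> * d\<^sup>2 > 0" using \<alpha> \<beta> d0 by simp
    then have "1 - 2 * \<alpha> + 2 * \<alpha> * d \<noteq> 0" using ang by auto
    then have "(cmod ((1 + of_real \<alpha> * (x - 1)) * 1))\<^sup>2 \<noteq> 0"
      unfolding first_collision_gram(2)[OF x] dx[symmetric] by simp
    then have u: "(1 + of_real \<alpha> * (x - 1)) * 1 \<noteq> 0" by auto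
    have "steerable \<beta> \<alpha> (2 * n - 2) ((1 + of_real \<alpha> * (x - 1)) * 1) (x * 1)"
      using steer[OF _ x dx u \<psi>(1) \<psi>2 ang] d0 \<psi> \<beta>d by simp
    then show ?L using x by (intro exI[of _ 1] exI[of _ x]) simp
  qed
qed

section \<open>Monotonicity of the trigonometric quotients\<close>

text \<open>The difference of the two sides vanishes at 0 and has derivative
  \<open>(N\<^sup>2 - 1) * sin t * sin (N * t)\<close>. It is also the numerator of the derivative
  of \<open>sin t / sin (N * t)\<close>.\<close>

lemma cos_sin_less_mult:
  fixes N t :: real
  assumes N: "N > 1" and t: "0 < t" "N * t < pi"
  shows "N * sin t * cos (N * t) < cos t * sin (N * t)"
proof -
  let ?h = "\<lambda>t. cos t * sin (N * t) - N * sin t * cos (N * t)"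
  have "?h 0 < ?h t"
  proof (rule DERIV_pos_imp_increasing_open[OF t(1)])
    fix x assume x: "0 < x" "x < t"
    have "N * x < N * t" "1 * x < N * x" using x N by (simp_all del: mult_1)
    then have Nx: "N * x < pi" "x < N * x" using t by linarith+
    have "x < pi" "0 < N * x" using Nx x(1) by linarith+
    then have "sin x > 0" "sin (N * x) > 0" using x(1) Nx(1) by (simp_all only: sin_gt_zero)
    moreover have "N\<^sup>2 > 1" using N by simp
    ultimately have "(N\<^sup>2 - 1) * sin x * sin (N * x) > 0" by simp
    moreover have "DERIV ?h x :> (N\<^sup>2 - 1) * sin x * sin (N * x)"
      by (auto intro!: derivative_eq_intros simp: algebra_simps power2_eq_square)
    ultimately show "\<exists>y. DERIV ?h x :> y \<and> y > 0" by blast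
  qed (intro continuous_intros)
  then show ?thesis by simp
qed

lemma sin_ratio_strict_mono:
  fixes N x y :: real
  assumes N: "N > 1" and xy: "0 < x" "x < y" "N * y < pi"
  shows "sin x / sin (N * x) < sin y / sin (N * y)"
proof (rule DERIV_pos_imp_increasing[OF xy(2)])
  fix t assume t: "x \<le> t" "t \<le> y"
  have "N * t \<le> N * y" using t N by simp
  then have t': "0 < t" "N * t < pi" using t xy by linarith+
  then have s: "sin (N * t) > 0" using N by (intro sin_gt_zero) auto
  have "DERIV (\<lambda>x. sin x / sin (N * x)) t :>
      (cos t * sin (N * t) - N * sin t * cos (N * t)) / (sin (N * t))\<^sup>2"
    using s by (auto intro!: derivative_eq_intros simp: power2_eq_square field_simps)
  moreover have "(cos t * sin (N * t) - N * sin t * cos (N * t)) / (sin (N * t))\<^sup>2 > 0"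
    using cos_sin_less_mult[OF N t'] s by simp
  ultimately show "\<exists>d. DERIV (\<lambda>x. sin x / sin (N * x)) t :> d \<and> d > 0" by blast
qed

text \<open>The range reaches up to \<open>2 * pi\<close> because a doubled angle will be inserted.
  While \<open>N * y < pi\<close>, the difference grows from 0 since cosine decreases; after that
  the left side is no longer positive.\<close>

lemma sin_multiple_less:
  fixes N y :: real
  assumes N: "N > 1" and y: "0 < y" "y < pi" "N * y < 2 * pi"
  shows "sin (N * y) < N * sin y"
proof (cases "N * y < pi")
  case True
  let ?h = "\<lambda>y. N * sin y - sin (N * y)"
  have "?h 0 < ?h y"
  proof (rule DERIV_pos_imp_increasing_open[OF y(1)])
    fix x assume x: "0 < x" "x < y"
    have "N * x < N * y" "1 * x < N * x" using x N by (simp_all del: mult_1)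
    then have Nx: "N * x < pi" "x < N * x" using True by linarith+
    then have "cos (N * x) < cos x" using x by (intro cos_monotone_0_pi) auto
    then have "N * cos x - N * cos (N * x) > 0" using N by simp
    moreover have "DERIV ?h x :> N * cos x - N * cos (N * x)"
      by (auto intro!: derivative_eq_intros)
    ultimately show "\<exists>d. DERIV ?h x :> d \<and> d > 0" by blast
  qed (intro continuous_intros)
  then show ?thesis by simp
next
  case False
  then have "sin (N * y) \<le> 0" using y by (intro sin_le_zero) auto
  moreover have "sin y > 0" using y by (intro sin_gt_zero) auto
  then have "N * sin y > 0" using N by simp
  ultimately show ?thesis by linarith
qed

text \<open>Up to sign, the mass ratio \<open>a\<close> along both curves once \<open>\<psi>\<close>
  is their parameter.\<close>

definition tan_cot :: "real \<Rightarrow> real \<Rightarrow> real" where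
  "tan_cot N \<psi> = tan \<psi> * cot (N * \<psi>)"

lemma less_half_pi:
  fixes N t :: real
  assumes "N \<ge> 2" "0 < t" "N * t < pi"
  shows "t < pi / 2"
proof -
  have "2 * t \<le> N * t" using assms by (intro mult_right_mono) auto
  then show ?thesis using assms by linarith
qed

text \<open>The numerator of the derivative is half of
  \<open>sin (N * (2 * t)) - N * sin (2 * t)\<close>, hence negative.\<close>

lemma tan_cot_strict_antimono:
  fixes N x y :: real
  assumes N: "N \<ge> 2" and xy: "0 < x" "x < y" "N * y < pi"
  shows "tan_cot N y < tan_cot N x"
proof -
  let ?f = "\<lambda>t. (sin t * cos (N * t)) / (cos t * sin (N * t))"
  have "?f y < ?f x"
  proof (rule DERIV_neg_imp_decreasing[OF xy(2)])
    fix t assume t: "x \<le> t" "t \<le> y"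
    have "N * t \<le> N * y" using t N by simp
    then have t': "0 < t" "N * t < pi" using t xy by linarith+
    then have s: "sin (N * t) > 0" using N by (intro sin_gt_zero) auto
    note t2 = less_half_pi[OF N t']
    then have c: "cos t > 0" using t' by (intro cos_gt_zero) auto
    have "sin (N * (2 * t)) < N * sin (2 * t)"
      using N t' t2 by (intro sin_multiple_less) auto
    also have "N * (2 * t) = 2 * (N * t)" by simp
    finally have less: "sin (N * t) * cos (N * t) < N * sin t * cos t"
      unfolding sin_double by simp
    have "(cos t * cos (N * t) - N * sin t * sin (N * t)) * (cos t * sin (N * t))
        - (sin t * cos (N * t)) * (N * cos t * cos (N * t) - sin t * sin (N * t))
        = ((sin t)\<^sup>2 + (cos t)\<^sup>2) * (sin (N * t) * cos (N * t))
          - N * sin t * cos t * ((sin (N * t))\<^sup>2 + (cos (N * t))\<^sup>2)"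
      by (simp only: algebra_simps power2_eq_square)
    also have "\<dots> < 0" using less by simp
    finally have neg: "(cos t * cos (N * t) - N * sin t * sin (N * t)) * (cos t * sin (N * t))
        - (sin t * cos (N * t)) * (N * cos t * cos (N * t) - sin t * sin (N * t)) < 0" .
    have "DERIV ?f t :> ((cos t * cos (N * t) - N * sin t * sin (N * t)) * (cos t * sin (N * t))
        - (sin t * cos (N * t)) * (N * cos t * cos (N * t) - sin t * sin (N * t)))
        / ((cos t * sin (N * t)) * (cos t * sin (N * t)))"
      by (rule DERIV_divide) (use s c in \<open>auto intro!: derivative_eq_intros simp: algebra_simps\<close>)
    moreover have "((cos t * cos (N * t) - N * sin t * sin (N * t)) * (cos t * sin (N * t))
        - (sin t * cos (N * t)) * (N * cos t * cos (N * t) - sin t * sin (N * t)))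
        / ((cos t * sin (N * t)) * (cos t * sin (N * t))) < 0"
      using neg s c by (intro divide_neg_pos) auto
    ultimately show "\<exists>d. DERIV ?f t :> d \<and> d < 0" by blast
  qed
  then show ?thesis by (simp add: tan_cot_def tan_def cot_def)
qed

text \<open>Both right sides contain \<open>(cos \<psi>)\<^sup>2 * (1 - tan_cot N \<psi>)\<close>,
  so comparing the energy equation with the scattering bounds becomes a cancellation.\<close>

lemma trig_in_terms_of_tan_cot:
  assumes "sin (N * \<psi>) \<noteq> 0" "cos \<psi> \<noteq> 0"
  shows "cos \<psi> * sin ((N - 1) * \<psi>) / sin (N * \<psi>) = (cos \<psi>)\<^sup>2 * (1 - tan_cot N \<psi>)"
    and "1 - (sin \<psi> / sin (N * \<psi>))\<^sup>2 = (cos \<psi>)\<^sup>2 * (1 - (tan_cot N \<psi>)\<^sup>2)"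
proof -
  have "(N - 1) * \<psi> = N * \<psi> - \<psi>" by (simp add: algebra_simps)
  then have s: "sin ((N - 1) * \<psi>) / sin (N * \<psi>) = cos \<psi> * (1 - tan_cot N \<psi>)"
    using assms by (simp add: sin_diff tan_cot_def tan_def cot_def field_simps)
  then show "cos \<psi> * sin ((N - 1) * \<psi>) / sin (N * \<psi>) = (cos \<psi>)\<^sup>2 * (1 - tan_cot N \<psi>)"
    by (simp add: power2_eq_square mult.assoc flip: times_divide_eq_right)
  have "1 - (sin \<psi> / sin (N * \<psi>))\<^sup>2
      = - ((cos \<psi> * (1 - tan_cot N \<psi>))\<^sup>2 - 2 * cos \<psi> * (cos \<psi> * (1 - tan_cot N \<psi>)))"
    using sin_ratio_quadratic[OF assms(1)] unfolding s by linarith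
  also have "\<dots> = (cos \<psi>)\<^sup>2 * (1 - (tan_cot N \<psi>)\<^sup>2)"
    by (simp add: power2_eq_square algebra_simps)
  finally show "1 - (sin \<psi> / sin (N * \<psi>))\<^sup>2 = (cos \<psi>)\<^sup>2 * (1 - (tan_cot N \<psi>)\<^sup>2)" .
qed

text \<open>With \<open>S\<close> for \<open>tan_cot N \<psi>\<close>, the energy equation says
  \<open>(1 - a) * \<beta> = F * (1 + S)\<close>. As \<open>a < 1\<close> makes \<open>F\<close>
  positive, multiplying the upper bound by \<open>1 - a\<close> and cancelling \<open>F\<close>
  leaves \<open>- S \<le> a\<close>; the lower bound leaves \<open>S \<le> a\<close> in the same
  way.\<close>

lemma scattering_bounds_iff_tan_cot:
  fixes a \<beta> N \<psi> :: real
  assumes a: "0 < a" "a < 1" and \<beta>: "0 < \<beta>" and N: "N \<ge> 2" and \<psi>: "0 < \<psi>" "N * \<psi> < pi"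
    and E: "(sin \<psi> / sin (N * \<psi>))\<^sup>2 = 1 - (1 - a) * \<beta>"
  defines "F \<equiv> cos \<psi> * sin ((N - 1) * \<psi>) / sin (N * \<psi>)"
  shows "(1 - a) / (1 + a) * \<beta> \<le> F \<and> F \<le> \<beta> \<longleftrightarrow> \<bar>tan_cot N \<psi>\<bar> \<le> a"
proof -
  define S where "S = tan_cot N \<psi>"
  define C where "C = (cos \<psi>)\<^sup>2"
  have sN: "sin (N * \<psi>) > 0" using \<psi> N by (intro sin_gt_zero) auto
  have c: "cos \<psi> > 0" using less_half_pi[OF N \<psi>] \<psi> by (intro cos_gt_zero) auto
  then have C: "C > 0" by (simp add: C_def)
  have F: "F = C * (1 - S)" and eq: "(1 - a) * \<beta> = C * (1 - S\<^sup>2)"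
    using trig_in_terms_of_tan_cot[of N \<psi>] sN c E by (simp_all add: F_def C_def S_def)
  have "C * (1 - S\<^sup>2) > 0" unfolding eq[symmetric] using a \<beta> by simp
  then have "S\<^sup>2 < 1" using C by (simp add: zero_less_mult_iff)
  then have S: "S < 1" "- 1 < S" by (auto simp: abs_square_less_1)
  have CS: "C * (1 - S) > 0" using C S by simp
  have "F \<le> \<beta> \<longleftrightarrow> (1 - a) * F \<le> (1 - a) * \<beta>" using a by simp
  also have "\<dots> \<longleftrightarrow> (C * (1 - S)) * (1 - a) \<le> (C * (1 - S)) * (1 + S)"
    unfolding eq F by (simp add: algebra_simps power2_eq_square)
  also have "\<dots> \<longleftrightarrow> - S \<le> a"
    unfolding mult_le_cancel_left_pos[OF CS] by linarith
  finally have 1: "F \<le> \<beta> \<longleftrightarrow> - S \<le> a" .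
  have "(1 - a) / (1 + a) * \<beta> \<le> F \<longleftrightarrow> (1 - a) * \<beta> \<le> (1 + a) * F"
    using a by (simp add: field_simps)
  also have "\<dots> \<longleftrightarrow> (C * (1 - S)) * (1 + S) \<le> (C * (1 - S)) * (1 + a)"
    unfolding eq F by (simp add: algebra_simps power2_eq_square)
  also have "\<dots> \<longleftrightarrow> S \<le> a"
    unfolding mult_le_cancel_left_pos[OF CS] by linarith
  finally show ?thesis using 1 unfolding S_def by auto
qed

section \<open>The boundary curves\<close>

lemma cot_npi_diff: "cot (real n * pi - z) = - cot z"
  by (simp add: cot_def sin_diff cos_diff)

text \<open>Under \<open>\<theta> = pi - 2 * \<psi>\<close> the half angle becomes complementary and
  the other angles are reflected modulo \<open>pi\<close>. The ends of the parameter interval change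
  places.\<close>

lemma C_odd_iff:
  assumes n: "n \<ge> 1"
  defines "N \<equiv> 2 * real n"
  shows "(a, b) \<in> C_odd n \<longleftrightarrow> (\<exists>\<psi>. pi / 2 < N * \<psi> \<and> (N - 1) * \<psi> < pi / 2 \<and>
    a = - tan_cot N \<psi> \<and> b = - cot (N * \<psi>) * tan ((N - 1) * \<psi>))"
proof -
  have trig: "cot (\<theta> / 2) = tan \<psi>" "cot (real n * \<theta>) = - cot (N * \<psi>)"
      "cot ((real n - 1 / 2) * \<theta>) = tan ((N - 1) * \<psi>)" if "\<theta> = pi - 2 * \<psi>" for \<theta> \<psi>
  proof -
    have "\<theta> / 2 = pi / 2 - \<psi>" "real n * \<theta> = real n * pi - N * \<psi>"
      "(real n - 1 / 2) * \<theta> = real n * pi - (pi / 2 + (N - 1) * \<psi>)"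
      unfolding that N_def by (simp_all add: algebra_simps diff_divide_distrib)
    then show "cot (\<theta> / 2) = tan \<psi>" "cot (real n * \<theta>) = - cot (N * \<psi>)"
      "cot ((real n - 1 / 2) * \<theta>) = tan ((N - 1) * \<psi>)"
      by (simp_all only: cot_npi_diff)
        (simp_all add: cot_def tan_def sin_diff cos_diff sin_add cos_add)
  qed
  have rng: "(2 * real n - 2) * pi / (2 * real n - 1) < \<theta> \<longleftrightarrow> (N - 1) * \<psi> < pi / 2"
      "\<theta> < (2 * real n - 1) * pi / (2 * real n) \<longleftrightarrow> pi / 2 < N * \<psi>" if "\<theta> = pi - 2 * \<psi>" for \<theta> \<psi>
    using n unfolding that N_def by (auto simp: field_simps)
  show ?thesis
  proof
    assume "(a, b) \<in> C_odd n"
    then obtain \<theta> where \<theta>: "a = cot (\<theta> / 2) * cot (real n * \<theta>)"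
      "b = cot (real n * \<theta>) * cot ((real n - 1 / 2) * \<theta>)"
      "(2 * real n - 2) * pi / (2 * real n - 1) < \<theta>" "\<theta> < (2 * real n - 1) * pi / (2 * real n)"
      unfolding C_odd_def by blast
    have "\<theta> = pi - 2 * ((pi - \<theta>) / 2)" by (simp add: field_simps)
    from \<theta> show "\<exists>\<psi>. pi / 2 < N * \<psi> \<and> (N - 1) * \<psi> < pi / 2 \<and>
      a = - tan_cot N \<psi> \<and> b = - cot (N * \<psi>) * tan ((N - 1) * \<psi>)"
      unfolding trig[OF \<open>\<theta> = _\<close>] rng[OF \<open>\<theta> = _\<close>] tan_cot_def by (intro exI[of _ "(pi - \<theta>) / 2"]) simp
  next
    assume "\<exists>\<psi>. pi / 2 < N * \<psi> \<and> (N - 1) * \<psi> < pi / 2 \<and>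
      a = - tan_cot N \<psi> \<and> b = - cot (N * \<psi>) * tan ((N - 1) * \<psi>)"
    then obtain \<psi> where \<psi>: "pi / 2 < N * \<psi>" "(N - 1) * \<psi> < pi / 2"
      "a = - tan_cot N \<psi>" "b = - cot (N * \<psi>) * tan ((N - 1) * \<psi>)" by blast
    define \<theta> where "\<theta> = pi - 2 * \<psi>"
    have "a = cot (\<theta> / 2) * cot (real n * \<theta>)"
      "b = cot (real n * \<theta>) * cot ((real n - 1 / 2) * \<theta>)"
      unfolding trig[OF \<theta>_def] \<psi> tan_cot_def by simp_all
    then show "(a, b) \<in> C_odd n" unfolding C_odd_def using rng[OF \<theta>_def] \<psi> by blast
  qed
qed

lemma C_even_iff:
  assumes n: "n \<ge> 1"
  defines "N \<equiv> 2 * real n"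
  shows "(a, b) \<in> C_even n \<longleftrightarrow> (\<exists>\<psi>. pi / 2 < (N + 1) * \<psi> \<and> N * \<psi> < pi / 2 \<and>
    a = tan_cot N \<psi> \<and> b = - cot (N * \<psi>) * tan ((N + 1) * \<psi>))"
proof -
  have trig: "cot (\<theta> / 2) = tan \<psi>" "cot (real n * \<theta>) = - cot (N * \<psi>)"
      "cot ((real n + 1 / 2) * \<theta>) = tan ((N + 1) * \<psi>)" if "\<theta> = pi - 2 * \<psi>" for \<theta> \<psi>
  proof -
    have "\<theta> / 2 = pi / 2 - \<psi>" "real n * \<theta> = real n * pi - N * \<psi>"
      "(real n + 1 / 2) * \<theta> = real n * pi - ((N + 1) * \<psi> - pi / 2)"
      unfolding that N_def by (simp_all add: algebra_simps diff_divide_distrib)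
    then show "cot (\<theta> / 2) = tan \<psi>" "cot (real n * \<theta>) = - cot (N * \<psi>)"
      "cot ((real n + 1 / 2) * \<theta>) = tan ((N + 1) * \<psi>)"
      by (simp_all only: cot_npi_diff)
        (simp_all add: cot_def tan_def sin_diff cos_diff sin_add cos_add)
  qed
  have rng: "(2 * real n - 1) * pi / (2 * real n) < \<theta> \<longleftrightarrow> N * \<psi> < pi / 2"
      "\<theta> < 2 * real n * pi / (2 * real n + 1) \<longleftrightarrow> pi / 2 < (N + 1) * \<psi>" if "\<theta> = pi - 2 * \<psi>" for \<theta> \<psi>
    using n unfolding that N_def by (auto simp: field_simps)
  show ?thesis
  proof
    assume "(a, b) \<in> C_even n"
    then obtain \<theta> where \<theta>: "a = - cot (\<theta> / 2) * cot (real n * \<theta>)"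
      "b = cot (real n * \<theta>) * cot ((real n + 1 / 2) * \<theta>)"
      "(2 * real n - 1) * pi / (2 * real n) < \<theta>" "\<theta> < 2 * real n * pi / (2 * real n + 1)"
      unfolding C_even_def by blast
    have "\<theta> = pi - 2 * ((pi - \<theta>) / 2)" by (simp add: field_simps)
    from \<theta> show "\<exists>\<psi>. pi / 2 < (N + 1) * \<psi> \<and> N * \<psi> < pi / 2 \<and>
      a = tan_cot N \<psi> \<and> b = - cot (N * \<psi>) * tan ((N + 1) * \<psi>)"
      unfolding trig[OF \<open>\<theta> = _\<close>] rng[OF \<open>\<theta> = _\<close>] tan_cot_def by (intro exI[of _ "(pi - \<theta>) / 2"]) simp
  next
    assume "\<exists>\<psi>. pi / 2 < (N + 1) * \<psi> \<and> N * \<psi> < pi / 2 \<and>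
      a = tan_cot N \<psi> \<and> b = - cot (N * \<psi>) * tan ((N + 1) * \<psi>)"
    then obtain \<psi> where \<psi>: "pi / 2 < (N + 1) * \<psi>" "N * \<psi> < pi / 2"
      "a = tan_cot N \<psi>" "b = - cot (N * \<psi>) * tan ((N + 1) * \<psi>)" by blast
    define \<theta> where "\<theta> = pi - 2 * \<psi>"
    have "a = - cot (\<theta> / 2) * cot (real n * \<theta>)"
      "b = cot (real n * \<theta>) * cot ((real n + 1 / 2) * \<theta>)"
      unfolding trig[OF \<theta>_def] \<psi> tan_cot_def by simp_all
    then show "(a, b) \<in> C_even n" unfolding C_even_def using rng[OF \<theta>_def] \<psi> by blast
  qed
qed

text \<open>Points of either curve thus satisfy the same energy equation as capture angles, which
  makes the two comparable through the sine quotient.\<close>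

lemma curve_identity:
  assumes "sin (N * \<psi>) \<noteq> 0" "cos \<psi> \<noteq> 0" "\<bar>tan_cot N \<psi>\<bar> = a" "\<beta> = (cos \<psi>)\<^sup>2 * (1 + a)"
  shows "(sin \<psi> / sin (N * \<psi>))\<^sup>2 = 1 - (1 - a) * \<beta>"
proof -
  have "(tan_cot N \<psi>)\<^sup>2 = a\<^sup>2" using assms(3) by (metis power2_abs)
  then have "1 - (sin \<psi> / sin (N * \<psi>))\<^sup>2 = (cos \<psi>)\<^sup>2 * (1 - a\<^sup>2)"
    using trig_in_terms_of_tan_cot(2)[OF assms(1,2)] by simp
  also have "\<dots> = (1 - a) * \<beta>"
    unfolding assms(4) by (simp add: power2_eq_square algebra_simps)
  finally show ?thesis by simp
qed

lemma inverse_one_plus_tan_sq: "cos \<psi> \<noteq> 0 \<Longrightarrow> (cos \<psi>)\<^sup>2 = 1 / (1 + (tan \<psi>)\<^sup>2)"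
  for \<psi> :: real
  by (simp add: tan_sec inverse_eq_divide power_divide)

text \<open>In \<open>x = tan \<psi>\<close> and \<open>k = cot (N * \<psi>)\<close> everything is
  rational, and \<open>a + b\<close> simplifies to \<open>- k * (1 + x\<^sup>2) / (k + x)\<close>.
  The last equation says that the upper scattering bound is attained: this is the case of scattering
  factor 1, where the first collision changes nothing.\<close>

lemma C_odd_point:
  fixes N \<psi> :: real
  assumes N: "N \<ge> 2" and \<psi>: "pi / 2 < N * \<psi>" "(N - 1) * \<psi> < pi / 2"
  defines "a \<equiv> - tan_cot N \<psi>" and "b \<equiv> - cot (N * \<psi>) * tan ((N - 1) * \<psi>)"
  shows "0 < \<psi>" "N * \<psi> < pi" "0 < a" "0 < b" "b / (a + b) = (cos \<psi>)\<^sup>2 * (1 + a)"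
proof -
  have "0 < N * \<psi>" using \<psi>(1) pi_gt_zero by linarith
  then show pos: "0 < \<psi>" using N by (simp add: zero_less_mult_iff)
  have "1 * \<psi> \<le> (N - 1) * \<psi>" using N pos by (intro mult_right_mono) auto
  then have \<psi>2: "\<psi> < pi / 2" using \<psi>(2) by linarith
  have Nm: "(N - 1) * \<psi> = N * \<psi> - \<psi>" by (simp add: algebra_simps)
  show lt: "N * \<psi> < pi" using \<psi>(2) \<psi>2 unfolding Nm by linarith
  define x where "x = tan \<psi>"
  define k where "k = cot (N * \<psi>)"
  have c: "cos \<psi> > 0" and s: "sin \<psi> > 0"
    using pos \<psi>2 by (auto intro!: cos_gt_zero sin_gt_zero)
  have sN: "sin (N * \<psi>) > 0" using \<psi>(1) lt pi_gt_zero by (intro sin_gt_zero) linarith+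
  have cN: "cos (N * \<psi>) < 0" using \<psi>(1) lt cos_monotone_0_pi[of "pi / 2" "N * \<psi>"] pi_gt_zero
    by simp
  have "(N - 1) * \<psi> > 0" using N pos by simp
  then have cM: "cos ((N - 1) * \<psi>) > 0" using \<psi>(2) by (intro cos_gt_zero) auto
  have x: "x > 0" and k: "k < 0" using c s sN cN
    by (auto simp: x_def k_def tan_def cot_def divide_neg_pos)
  have "k + x = cos ((N - 1) * \<psi>) / (sin (N * \<psi>) * cos \<psi>)"
    unfolding Nm cos_diff using c sN by (simp add: x_def k_def tan_def cot_def field_simps)
  then have kx: "k + x > 0" using cM sN c by simp
  have "tan ((N - 1) * \<psi>) = (sin (N * \<psi>) * cos \<psi> - cos (N * \<psi>) * sin \<psi>)
      / (cos (N * \<psi>) * cos \<psi> + sin (N * \<psi>) * sin \<psi>)"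
    unfolding Nm tan_def sin_diff cos_diff ..
  also have "sin (N * \<psi>) * cos \<psi> - cos (N * \<psi>) * sin \<psi> = (sin (N * \<psi>) * cos \<psi>) * (1 - k * x)"
    using c sN by (simp add: x_def k_def tan_def cot_def field_simps)
  also have "cos (N * \<psi>) * cos \<psi> + sin (N * \<psi>) * sin \<psi> = (sin (N * \<psi>) * cos \<psi>) * (k + x)"
    using c sN by (simp add: x_def k_def tan_def cot_def field_simps)
  also have "((sin (N * \<psi>) * cos \<psi>) * (1 - k * x)) / ((sin (N * \<psi>) * cos \<psi>) * (k + x))
      = (1 - k * x) / (k + x)" using c sN by simp
  finally have b: "b = (- k) * ((1 - k * x) / (k + x))" by (simp add: b_def k_def)
  have a: "a = - k * x" by (simp add: a_def tan_cot_def x_def k_def)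
  have kx': "- (k * x) > 0" using x k by (simp add: mult_neg_pos)
  show a0: "0 < a" using kx' a by simp
  show "0 < b" unfolding b using k kx kx' by (intro mult_pos_pos divide_pos_pos) auto
  have ab: "a + b = (- k) * ((1 + x\<^sup>2) / (k + x))"
    unfolding a b using kx by (simp add: field_simps power2_eq_square)
  have x2: "1 + x\<^sup>2 > 0" by (simp add: add_pos_nonneg)
  have "b / (a + b) = (1 - k * x) / (1 + x\<^sup>2)"
    unfolding ab unfolding b using k kx x2 by simp
  then show "b / (a + b) = (cos \<psi>)\<^sup>2 * (1 + a)"
    using inverse_one_plus_tan_sq[of \<psi>] c a by (simp add: x_def)
qed

text \<open>The same computation with the addition formula and \<open>k - x < 0\<close>. Now the
  lower scattering bound is attained, so the first collision has scattering factor -1.\<close>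

lemma C_even_point:
  fixes N \<psi> :: real
  assumes N: "N \<ge> 2" and \<psi>: "pi / 2 < (N + 1) * \<psi>" "N * \<psi> < pi / 2"
  defines "a \<equiv> tan_cot N \<psi>" and "b \<equiv> - cot (N * \<psi>) * tan ((N + 1) * \<psi>)"
  shows "0 < \<psi>" "N * \<psi> < pi" "0 < a" "0 < b" "b / (a + b) = (cos \<psi>)\<^sup>2 * (1 + a)"
proof -
  have "0 < (N + 1) * \<psi>" using \<psi>(1) pi_gt_zero by linarith
  then show pos: "0 < \<psi>" using N by (simp add: zero_less_mult_iff)
  show lt: "N * \<psi> < pi" using \<psi>(2) pi_gt_zero by linarith
  note \<psi>2 = less_half_pi[OF N pos lt]
  have Nm: "(N + 1) * \<psi> = N * \<psi> + \<psi>" by (simp add: algebra_simps)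
  define x where "x = tan \<psi>"
  define k where "k = cot (N * \<psi>)"
  have c: "cos \<psi> > 0" and s: "sin \<psi> > 0"
    using pos \<psi>2 by (auto intro!: cos_gt_zero sin_gt_zero)
  have Npos: "N * \<psi> > 0" using N pos by simp
  have sN: "sin (N * \<psi>) > 0" using Npos lt by (intro sin_gt_zero) linarith+
  have cN: "cos (N * \<psi>) > 0" using Npos \<psi>(2) by (intro cos_gt_zero) auto
  have "(N + 1) * \<psi> \<le> pi" using \<psi>(2) \<psi>2 unfolding Nm by linarith
  then have cM: "cos ((N + 1) * \<psi>) < 0"
    using \<psi>(1) cos_monotone_0_pi[of "pi / 2" "(N + 1) * \<psi>"] pi_gt_zero by simp
  have x: "x > 0" and k: "k > 0" using c s sN cN
    by (auto simp: x_def k_def tan_def cot_def)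
  have "k - x = cos ((N + 1) * \<psi>) / (sin (N * \<psi>) * cos \<psi>)"
    unfolding Nm cos_add using c sN by (simp add: x_def k_def tan_def cot_def field_simps)
  then have kx: "k - x < 0" using cM sN c by (simp add: divide_neg_pos)
  have "tan ((N + 1) * \<psi>) = (sin (N * \<psi>) * cos \<psi> + cos (N * \<psi>) * sin \<psi>)
      / (cos (N * \<psi>) * cos \<psi> - sin (N * \<psi>) * sin \<psi>)"
    unfolding Nm tan_def sin_add cos_add ..
  also have "sin (N * \<psi>) * cos \<psi> + cos (N * \<psi>) * sin \<psi> = (sin (N * \<psi>) * cos \<psi>) * (1 + k * x)"
    using c sN by (simp add: x_def k_def tan_def cot_def field_simps)
  also have "cos (N * \<psi>) * cos \<psi> - sin (N * \<psi>) * sin \<psi> = (sin (N * \<psi>) * cos \<psi>) * (k - x)"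
    using c sN by (simp add: x_def k_def tan_def cot_def field_simps)
  also have "((sin (N * \<psi>) * cos \<psi>) * (1 + k * x)) / ((sin (N * \<psi>) * cos \<psi>) * (k - x))
      = (1 + k * x) / (k - x)" using c sN by simp
  finally have b: "b = k * ((1 + k * x) / (x - k))"
    using kx by (simp add: b_def k_def flip: minus_divide_right minus_divide_left) (simp add: field_simps)
  have a: "a = k * x" by (simp add: a_def tan_cot_def x_def k_def)
  show a0: "0 < a" using x k a by simp
  show "0 < b" unfolding b using k kx x by (intro mult_pos_pos divide_pos_pos) (auto simp: add_pos_pos)
  have ab: "a + b = k * ((1 + x\<^sup>2) / (x - k))"
    unfolding a b using kx by (simp add: field_simps power2_eq_square)
  have x2: "1 + x\<^sup>2 > 0" by (simp add: add_pos_nonneg)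
  have "b / (a + b) = (1 + k * x) / (1 + x\<^sup>2)"
    unfolding ab unfolding b using k kx x2 by simp
  then show "b / (a + b) = (cos \<psi>)\<^sup>2 * (1 + a)"
    using inverse_one_plus_tan_sq[of \<psi>] c a by (simp add: x_def)
qed

section \<open>Ranges of the curves and comparison of mass ratios\<close>

text \<open>Intermediate value theorem for \<open>a = - tan_cot N t\<close> with denominators
  cleared. Hypothesis \<open>e\<close> bounds \<open>a\<close> by the squared tangent at the upper
  endpoint; it is multiplied out because for \<open>N = 2\<close> that endpoint is
  \<open>pi / 2\<close>, where the tangent has a pole.\<close>

lemma C_odd_parameter_exists:
  fixes N a :: real
  assumes N: "N \<ge> 2" and a: "0 < a"
    and e: "a * (cos (pi / (2 * (N - 1))))\<^sup>2 < (sin (pi / (2 * (N - 1))))\<^sup>2"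
  shows "\<exists>\<psi>. pi / 2 < N * \<psi> \<and> (N - 1) * \<psi> < pi / 2 \<and> a = - tan_cot N \<psi>"
proof -
  let ?l = "pi / (2 * N)" and ?h = "pi / (2 * (N - 1))"
  let ?f = "\<lambda>t. sin t * cos (N * t) + a * (cos t * sin (N * t))"
  have "N * ?l = pi / 2" using N by (simp add: field_simps)
  moreover have "0 < ?l" "?l < pi / 2" using N pi_gt_zero by (auto simp: field_simps)
  then have "cos ?l > 0" by (intro cos_gt_zero) auto
  ultimately have fl: "?f ?l > 0" using a by (simp only: cos_pi_half sin_pi_half) simp
  have "N * ?h = pi / 2 + ?h" using N by (simp add: field_simps)
  then have "?f ?h = a * (cos ?h)\<^sup>2 - (sin ?h)\<^sup>2"
    by (simp only: sin_add cos_add) (simp add: power2_eq_square)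
  then have fh: "?f ?h < 0" using e by simp
  have lh: "?l \<le> ?h" using N pi_gt_zero by (intro divide_left_mono) auto
  have "\<exists>t\<ge>?l. t \<le> ?h \<and> ?f t = 0"
    by (rule IVT2') (use fl fh lh in \<open>auto intro!: continuous_intros\<close>)
  then obtain t where t: "?l \<le> t" "t \<le> ?h" "?f t = 0" by blast
  have "t \<noteq> ?l" "t \<noteq> ?h" using t(3) fl fh by auto
  then have t': "?l < t" "t < ?h" using t by auto
  have r: "pi / 2 < N * t" "(N - 1) * t < pi / 2" using t' N by (simp_all add: field_simps)
  note pt = C_odd_point(1,2)[OF N r]
  have "cos t > 0" "sin (N * t) > 0" using pt less_half_pi[OF N pt] N
    by (auto intro!: cos_gt_zero sin_gt_zero)
  then have "a = - tan_cot N t" using t(3) by (simp add: tan_cot_def tan_def cot_def field_simps)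
  then show ?thesis using r by blast
qed

lemma C_even_parameter_exists:
  fixes N a :: real
  assumes N: "N \<ge> 2" and a: "0 < a" and e: "a < (tan (pi / (2 * (N + 1))))\<^sup>2"
  shows "\<exists>\<psi>. pi / 2 < (N + 1) * \<psi> \<and> N * \<psi> < pi / 2 \<and> a = tan_cot N \<psi>"
proof -
  let ?l = "pi / (2 * (N + 1))" and ?h = "pi / (2 * N)"
  let ?f = "\<lambda>t. sin t * cos (N * t) - a * (cos t * sin (N * t))"
  have "N * ?h = pi / 2" using N by (simp add: field_simps)
  moreover have "0 < ?h" "?h < pi / 2" using N pi_gt_zero by (auto simp: field_simps)
  then have "cos ?h > 0" by (intro cos_gt_zero) auto
  ultimately have fh: "?f ?h < 0" using a by (simp only: cos_pi_half sin_pi_half) simp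
  have "N * ?l = pi / 2 - ?l" using N by (simp add: field_simps)
  then have f: "?f ?l = (sin ?l)\<^sup>2 - a * (cos ?l)\<^sup>2"
    by (simp only: sin_diff cos_diff) (simp add: power2_eq_square)
  have "0 < ?l" "?l < pi / 2" using N pi_gt_zero by (auto simp: field_simps)
  then have "cos ?l > 0" by (intro cos_gt_zero) auto
  then have fl: "?f ?l > 0" using e unfolding f by (simp add: tan_def power_divide field_simps)
  have lh: "?l \<le> ?h" using N pi_gt_zero by (intro divide_left_mono) auto
  have "\<exists>t\<ge>?l. t \<le> ?h \<and> ?f t = 0"
    by (rule IVT2') (use fl fh lh in \<open>auto intro!: continuous_intros\<close>)
  then obtain t where t: "?l \<le> t" "t \<le> ?h" "?f t = 0" by blast
  have "t \<noteq> ?l" "t \<noteq> ?h" using t(3) fl fh by auto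
  then have t': "?l < t" "t < ?h" using t by auto
  have r: "pi / 2 < (N + 1) * t" "N * t < pi / 2" using t' N by (simp_all add: field_simps)
  note pt = C_even_point(1,2)[OF N r]
  have "cos t > 0" "sin (N * t) > 0" using pt less_half_pi[OF N pt] N
    by (auto intro!: cos_gt_zero sin_gt_zero)
  then have "a = tan_cot N t" using t(3) by (simp add: tan_cot_def tan_def cot_def field_simps)
  then show ?thesis using r by blast
qed

text \<open>By the addition formula for \<open>sin (N * \<psi>)\<close>, a quotient below 1 forces
  \<open>cos ((N - 1) * \<psi>)\<close> to be positive. This keeps capture angles below the upper
  end of the parameter interval of \<open>C_odd\<close>.\<close>

lemma multiple_angle_bound:
  fixes N \<psi> :: real
  assumes N: "N \<ge> 2" and \<psi>: "0 < \<psi>" "N * \<psi> < pi"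
    and F: "cos \<psi> * sin ((N - 1) * \<psi>) / sin (N * \<psi>) < 1"
  shows "(N - 1) * \<psi> < pi / 2"
proof (rule ccontr)
  assume "\<not> ?thesis"
  then have ge: "pi / 2 \<le> (N - 1) * \<psi>" by simp
  have Nm: "N * \<psi> = (N - 1) * \<psi> + \<psi>" by (simp add: algebra_simps)
  have "(N - 1) * \<psi> \<le> pi" using \<psi> Nm by linarith
  then have "cos ((N - 1) * \<psi>) \<le> 0"
    using ge pi_gt_zero cos_monotone_0_pi_le[of "pi / 2" "(N - 1) * \<psi>"] by simp
  moreover have "sin \<psi> > 0" using less_half_pi[OF N \<psi>] \<psi> by (intro sin_gt_zero) auto
  ultimately have "sin \<psi> * cos ((N - 1) * \<psi>) \<le> 0" by (simp add: mult_nonneg_nonpos)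
  moreover have "sin (N * \<psi>) = cos \<psi> * sin ((N - 1) * \<psi>) + sin \<psi> * cos ((N - 1) * \<psi>)"
    unfolding Nm sin_add by simp
  moreover have "sin (N * \<psi>) > 0" using \<psi> N by (intro sin_gt_zero) auto
  ultimately show False using F by (simp add: field_simps)
qed

text \<open>Since \<open>b / (a + b)\<close> increases with \<open>b\<close>, the energy equation
  for \<open>a < 1\<close> reverses order: a heavier particle 3 means a smaller sine
  quotient.\<close>

lemma mass_ratio_le_iff:
  fixes a b b' q q' :: real
  assumes a: "0 < a" "a < 1" and b: "0 < b" "0 < b'" and q: "0 < q" "0 < q'"
    and "q\<^sup>2 = 1 - (1 - a) * (b / (a + b))" "q'\<^sup>2 = 1 - (1 - a) * (b' / (a + b'))"
  shows "b \<le> b' \<longleftrightarrow> q' \<le> q"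
proof -
  have "q' \<le> q \<longleftrightarrow> q'\<^sup>2 \<le> q\<^sup>2" using q by (simp add: power2_le_iff_abs_le)
  also have "\<dots> \<longleftrightarrow> (1 - a) * (b / (a + b)) \<le> (1 - a) * (b' / (a + b'))" using assms by simp
  also have "\<dots> \<longleftrightarrow> b / (a + b) \<le> b' / (a + b')"
    using a by (simp only: mult_le_cancel_left_pos diff_gt_0_iff_gt)
  also have "\<dots> \<longleftrightarrow> a * b \<le> a * b'" using a b by (simp add: field_simps)
  also have "\<dots> \<longleftrightarrow> b \<le> b'" using a by simp
  finally show ?thesis by simp
qed

text \<open>At this angle \<open>N * \<psi>\<close> exceeds a right angle by exactly
  \<open>\<psi>\<close>. The square of \<open>tan \<psi>\<close> is the right end of the range of
  \<open>a\<close> on the curve; \<open>N > 2\<close> leaves out the first curve, whose range is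
  unbounded.\<close>

lemma C_odd_endpoint:
  fixes N :: real
  assumes N: "N > 2"
  defines "\<psi> \<equiv> pi / (2 * (N - 1))"
  shows "0 < \<psi>" "N * \<psi> < pi" "sin \<psi> / sin (N * \<psi>) = tan \<psi>" "tan_cot N \<psi> = - (tan \<psi>)\<^sup>2"
proof -
  have "N * \<psi> = pi / 2 + \<psi>" using N by (simp add: \<psi>_def field_simps)
  then show "sin \<psi> / sin (N * \<psi>) = tan \<psi>" "tan_cot N \<psi> = - (tan \<psi>)\<^sup>2"
    by (simp_all add: tan_cot_def sin_add cos_add tan_def cot_def power2_eq_square)
  show "0 < \<psi>" "N * \<psi> < pi" using N pi_gt_zero by (simp_all add: \<psi>_def field_simps)
qed

text \<open>Here \<open>N * \<psi>\<close> falls short of a right angle by \<open>\<psi>\<close>.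
  The last bound shows that \<open>C_even\<close> stays within \<open>a < 1\<close>.\<close>

lemma C_even_endpoint:
  fixes N :: real
  assumes N: "N \<ge> 2"
  defines "\<psi> \<equiv> pi / (2 * (N + 1))"
  shows "0 < \<psi>" "N * \<psi> < pi / 2" "sin \<psi> / sin (N * \<psi>) = tan \<psi>" "tan_cot N \<psi> = (tan \<psi>)\<^sup>2"
    "0 < tan \<psi>" "(tan \<psi>)\<^sup>2 < 1"
proof -
  have "N * \<psi> = pi / 2 - \<psi>" using N by (simp add: \<psi>_def field_simps)
  then show "sin \<psi> / sin (N * \<psi>) = tan \<psi>" "tan_cot N \<psi> = (tan \<psi>)\<^sup>2"
    by (simp_all add: tan_cot_def sin_diff cos_diff tan_def cot_def power2_eq_square)
  show 0: "0 < \<psi>" "N * \<psi> < pi / 2" using N pi_gt_zero by (simp_all add: \<psi>_def field_simps)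
  have 4: "\<psi> < pi / 4" unfolding \<psi>_def using N pi_gt_zero by (intro divide_strict_left_mono) auto
  show t: "0 < tan \<psi>" using 0 4 by (intro tan_gt_zero) auto
  have "tan \<psi> < tan (pi / 4)" using 0 4 by (intro tan_monotone) auto
  then show "(tan \<psi>)\<^sup>2 < 1" using t by (simp add: tan_45 abs_square_less_1)
qed

lemma tan_C_odd_endpoint:
  assumes "N \<ge> (4::real)"
  defines "\<psi> \<equiv> pi / (2 * (N - 1))"
  shows "0 < tan \<psi>" "tan \<psi> < 1"
proof -
  have 4: "\<psi> < pi / 4" unfolding \<psi>_def
    using assms(1) pi_gt_zero by (intro divide_strict_left_mono) auto
  have 0: "0 < \<psi>" using assms(1) by (simp add: \<psi>_def)
  show "0 < tan \<psi>" using 0 4 by (intro tan_gt_zero) auto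
  show "tan \<psi> < 1" using tan_monotone[of \<psi> "pi / 4"] 0 4 by (simp add: tan_45)
qed

section \<open>Capture angles compared with the curves\<close>

text \<open>The criterion obtained from the recursion, with \<open>\<alpha> = 1 / (1 + a)\<close>
  and \<open>\<beta> = b / (a + b)\<close> inserted: the energy equation, then the two bounds that
  leave a unit scattering factor for the first collision.\<close>

definition capture_angle :: "real \<Rightarrow> real \<Rightarrow> real \<Rightarrow> real \<Rightarrow> bool" where
  "capture_angle N a b \<psi> \<longleftrightarrow> 0 < \<psi> \<and> N * \<psi> < pi \<and>
     (sin \<psi> / sin (N * \<psi>))\<^sup>2 = 1 - (1 - a) * (b / (a + b)) \<and>
     (1 - a) / (1 + a) * (b / (a + b)) \<le> cos \<psi> * sin ((N - 1) * \<psi>) / sin (N * \<psi>) \<and>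
     cos \<psi> * sin ((N - 1) * \<psi>) / sin (N * \<psi>) \<le> b / (a + b)"

lemma capture_angle_bound:
  assumes "0 < a" "0 < b" "N \<ge> 2" "capture_angle N a b \<psi>"
  shows "(N - 1) * \<psi> < pi / 2"
proof (rule multiple_angle_bound)
  have "b / (a + b) < 1" using assms by simp
  then show "cos \<psi> * sin ((N - 1) * \<psi>) / sin (N * \<psi>) < 1"
    using assms(4) unfolding capture_angle_def by linarith
qed (use assms in \<open>auto simp: capture_angle_def\<close>)

lemma sin_ratio_pos:
  assumes "N \<ge> (2::real)" "0 < \<psi>" "N * \<psi> < pi"
  shows "0 < sin \<psi> / sin (N * \<psi>)" "sin (N * \<psi>) > 0" "cos \<psi> > 0"
proof -
  show "sin (N * \<psi>) > 0" using assms by (intro sin_gt_zero) auto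
  moreover have "sin \<psi> > 0" using less_half_pi[OF assms] assms by (intro sin_gt_zero) auto
  ultimately show "0 < sin \<psi> / sin (N * \<psi>)" by simp
  show "cos \<psi> > 0" using less_half_pi[OF assms] assms by (intro cos_gt_zero) auto
qed

lemma C_odd_energy:
  assumes n: "n \<ge> 1" and ab: "(a, b) \<in> C_odd n"
  obtains \<psi> where "pi / 2 < (2 * real n) * \<psi>" "(2 * real n - 1) * \<psi> < pi / 2" "0 < \<psi>"
    "(2 * real n) * \<psi> < pi" "0 < a" "0 < b" "a = - tan_cot (2 * real n) \<psi>"
    "(sin \<psi> / sin ((2 * real n) * \<psi>))\<^sup>2 = 1 - (1 - a) * (b / (a + b))"
proof -
  have N: "2 * real n \<ge> 2" using n by simp
  obtain \<psi> where \<psi>: "pi / 2 < (2 * real n) * \<psi>" "(2 * real n - 1) * \<psi> < pi / 2"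
    "a = - tan_cot (2 * real n) \<psi>" "b = - cot ((2 * real n) * \<psi>) * tan ((2 * real n - 1) * \<psi>)"
    using ab unfolding C_odd_iff[OF n] by blast
  note p = C_odd_point[OF N \<psi>(1,2), folded \<psi>(3,4)]
  have "(sin \<psi> / sin ((2 * real n) * \<psi>))\<^sup>2 = 1 - (1 - a) * (b / (a + b))"
    by (rule curve_identity) (use p \<psi> sin_ratio_pos[OF N p(1,2)] in auto)
  then show thesis using that \<psi> p by blast
qed

lemma C_even_energy:
  assumes n: "n \<ge> 1" and ab: "(a, b) \<in> C_even n"
  obtains \<psi> where "pi / 2 < (2 * real n + 1) * \<psi>" "(2 * real n) * \<psi> < pi / 2" "0 < \<psi>"
    "0 < a" "0 < b" "a = tan_cot (2 * real n) \<psi>"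
    "(sin \<psi> / sin ((2 * real n) * \<psi>))\<^sup>2 = 1 - (1 - a) * (b / (a + b))"
proof -
  have N: "2 * real n \<ge> 2" using n by simp
  obtain \<psi> where \<psi>: "pi / 2 < (2 * real n + 1) * \<psi>" "(2 * real n) * \<psi> < pi / 2"
    "a = tan_cot (2 * real n) \<psi>" "b = - cot ((2 * real n) * \<psi>) * tan ((2 * real n + 1) * \<psi>)"
    using ab unfolding C_even_iff[OF n] by blast
  note p = C_even_point[OF N \<psi>(1,2), folded \<psi>(3,4)]
  have "(sin \<psi> / sin ((2 * real n) * \<psi>))\<^sup>2 = 1 - (1 - a) * (b / (a + b))"
    by (rule curve_identity) (use p \<psi> sin_ratio_pos[OF N p(1,2)] in auto)
  then show thesis using that \<psi> p by blast
qed

text \<open>The sine quotient increases with \<open>\<psi>\<close> and \<open>tan_cot\<close>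
  decreases. A capture angle therefore lies between the angle with \<open>tan_cot\<close> equal to
  \<open>a\<close>, which belongs to \<open>C_even\<close>, and the one with value
  \<open>- a\<close>, which belongs to \<open>C_odd\<close>. Comparing sine quotients at these
  angles compares the values of \<open>b\<close>.\<close>

lemma capture_angle_iff_between_curves_less_1:
  assumes a: "0 < a" "a < 1" and b: "0 < b" and n: "n \<ge> 1"
  shows "(\<exists>\<psi>. capture_angle (2 * real n) a b \<psi>) \<longleftrightarrow>
    (\<exists>b'. b' \<le> b \<and> (a, b') \<in> C_odd n) \<and> (\<forall>b''. (a, b'') \<in> C_even n \<longrightarrow> b \<le> b'')"
proof -
  define N where "N = 2 * real n"
  define Q where "Q \<psi> = sin \<psi> / sin (N * \<psi>)" for \<psi>
  have N: "N \<ge> 2" using n by (simp add: N_def)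
  have \<beta>: "0 < b / (a + b)" "b / (a + b) < 1" using a b by simp_all
  have cap: "capture_angle N a b \<psi> \<longleftrightarrow> 0 < \<psi> \<and> N * \<psi> < pi \<and>
      (Q \<psi>)\<^sup>2 = 1 - (1 - a) * (b / (a + b)) \<and> \<bar>tan_cot N \<psi>\<bar> \<le> a" for \<psi>
    unfolding capture_angle_def Q_def using scattering_bounds_iff_tan_cot[OF a \<beta>(1) N] by blast
  have gt_a: "1 - (1 - a) * (b / (a + b)) > a"
  proof -
    have "(1 - a) * (b / (a + b)) < (1 - a) * 1" using a \<beta> by (intro mult_strict_left_mono) auto
    then show ?thesis by simp
  qed
  have Q_pos: "Q \<psi> > 0" if "0 < \<psi>" "N * \<psi> < pi" for \<psi>
    using sin_ratio_pos[OF N that] by (simp add: Q_def)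
  have Q_le: "Q x \<le> Q y \<longleftrightarrow> x \<le> y" and T_le: "tan_cot N x \<le> tan_cot N y \<longleftrightarrow> y \<le> x"
    if "0 < x" "0 < y" "N * x < pi" "N * y < pi" for x y
    using that N sin_ratio_strict_mono[of N x y] sin_ratio_strict_mono[of N y x]
      tan_cot_strict_antimono[of N x y] tan_cot_strict_antimono[of N y x]
    unfolding Q_def by (cases x y rule: linorder_cases; force)+
  show ?thesis
  proof (unfold N_def[symmetric], intro iffI conjI allI impI)
    assume "\<exists>\<psi>. capture_angle N a b \<psi>"
    then obtain \<psi> where c: "capture_angle N a b \<psi>" by blast
    then have \<psi>: "0 < \<psi>" "N * \<psi> < pi" and E: "(Q \<psi>)\<^sup>2 = 1 - (1 - a) * (b / (a + b))"
      and T: "\<bar>tan_cot N \<psi>\<bar> \<le> a" unfolding cap by auto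
    have half: "(N - 1) * \<psi> < pi / 2" by (rule capture_angle_bound[OF a(1) b N c])
    let ?e = "pi / (2 * (N - 1))"
    have "a * (cos ?e)\<^sup>2 < (sin ?e)\<^sup>2"
    \<comment> \<open>For \<open>N = 2\<close> the endpoint is a right angle and the claim is
      \<open>0 < 1\<close>. Otherwise \<open>tan ?e\<close> is the sine quotient at the endpoint, so
      it exceeds \<open>Q \<psi>\<close>, whose square exceeds \<open>a\<close>.\<close>
    proof (cases "N = 2")
      case True then show ?thesis by simp
    next
      case False
      then have N2: "N > 2" using N by simp
      note e = C_odd_endpoint[OF N2]
      have "\<psi> < ?e" using half N2 by (simp add: field_simps)
      then have "Q \<psi> < tan ?e" unfolding Q_def e(3)[symmetric]
        using N \<psi> e(2) by (intro sin_ratio_strict_mono) auto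
      then have "(Q \<psi>)\<^sup>2 < (tan ?e)\<^sup>2" using Q_pos[OF \<psi>] by (intro power_strict_mono) auto
      then have "a < (tan ?e)\<^sup>2" using E gt_a by simp
      moreover have "cos ?e > 0" by (rule sin_ratio_pos(3)[OF N e(1,2)])
      ultimately show ?thesis by (simp add: tan_def power_divide field_simps)
    qed
    from C_odd_parameter_exists[OF N a(1) this] obtain \<psi>' where
      r: "pi / 2 < N * \<psi>'" "(N - 1) * \<psi>' < pi / 2" "a = - tan_cot N \<psi>'" by blast
    define b' where "b' = - cot (N * \<psi>') * tan ((N - 1) * \<psi>')"
    note p = C_odd_point[OF N r(1,2), folded r(3) b'_def]
    have "(a, b') \<in> C_odd n" unfolding C_odd_iff[OF n] N_def[symmetric] using r b'_def by blast
    moreover have "(Q \<psi>')\<^sup>2 = 1 - (1 - a) * (b' / (a + b'))"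
      unfolding Q_def by (rule curve_identity) (use p r sin_ratio_pos[OF N p(1,2)] in auto)
    moreover have "Q \<psi> \<le> Q \<psi>'" using Q_le T_le T r(3) \<psi> p(1,2) by force
    ultimately show "\<exists>b'. b' \<le> b \<and> (a, b') \<in> C_odd n"
      using mass_ratio_le_iff[OF a p(4) b Q_pos[OF p(1,2)] Q_pos[OF \<psi>]] E by blast
  next
    fix b'' assume "\<exists>\<psi>. capture_angle N a b \<psi>" and in_even: "(a, b'') \<in> C_even n"
    then obtain \<psi> where c: "capture_angle N a b \<psi>" by blast
    then have \<psi>: "0 < \<psi>" "N * \<psi> < pi" and E: "(Q \<psi>)\<^sup>2 = 1 - (1 - a) * (b / (a + b))"
      and T: "\<bar>tan_cot N \<psi>\<bar> \<le> a" unfolding cap by auto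
    obtain \<psi>' where \<psi>': "N * \<psi>' < pi / 2" "0 < \<psi>'" "0 < b''" "a = tan_cot N \<psi>'"
      "(Q \<psi>')\<^sup>2 = 1 - (1 - a) * (b'' / (a + b''))"
      using C_even_energy[OF n in_even] unfolding N_def Q_def by metis
    have lt: "N * \<psi>' < pi" using \<psi>'(1) pi_gt_zero by linarith
    have "Q \<psi>' \<le> Q \<psi>" using Q_le T_le T \<psi>' lt \<psi> by force
    then show "b \<le> b''"
      using mass_ratio_le_iff[OF a b \<psi>'(3) Q_pos[OF \<psi>] Q_pos[OF \<psi>'(2) lt] E \<psi>'(5)] by blast
  next
    assume "(\<exists>b'. b' \<le> b \<and> (a, b') \<in> C_odd n) \<and> (\<forall>b''. (a, b'') \<in> C_even n \<longrightarrow> b \<le> b'')"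
    then obtain b' where b': "b' \<le> b" "(a, b') \<in> C_odd n"
      and even: "\<And>b''. (a, b'') \<in> C_even n \<Longrightarrow> b \<le> b''" by blast
    obtain \<psi>1 where 1: "pi / 2 < N * \<psi>1" "0 < \<psi>1" "N * \<psi>1 < pi" "0 < b'" "a = - tan_cot N \<psi>1"
      "(Q \<psi>1)\<^sup>2 = 1 - (1 - a) * (b' / (a + b'))"
      using C_odd_energy[OF n b'(2)] unfolding N_def Q_def by metis
    \<comment> \<open>The value that the energy equation prescribes for \<open>Q\<close>. It is to
      be attained between an angle \<open>\<psi>0\<close> with a smaller or equal quotient and the
      angle \<open>\<psi>1\<close> of \<open>C_odd\<close>.\<close>
    define q where "q = sqrt (1 - (1 - a) * (b / (a + b)))"
    have q: "0 < q" "q\<^sup>2 = 1 - (1 - a) * (b / (a + b))" using gt_a a by (simp_all add: q_def)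
    have q1: "q \<le> Q \<psi>1" using mass_ratio_le_iff[OF a 1(4) b Q_pos[OF 1(2,3)] q(1) 1(6) q(2)] b' by blast
    \<comment> \<open>If \<open>C_even\<close> does not reach \<open>a\<close>, the lower end of its
      parameter interval serves as \<open>\<psi>0\<close>: there \<open>Q\<close> is a tangent whose
      square is at most \<open>a\<close>, hence below \<open>q\<^sup>2\<close>.\<close>
    have "\<exists>\<psi>0. 0 < \<psi>0 \<and> N * \<psi>0 < pi / 2 \<and> Q \<psi>0 \<le> q \<and> tan_cot N \<psi>0 \<le> a"
    proof (cases "a < (tan (pi / (2 * (N + 1))))\<^sup>2")
      case True
      from C_even_parameter_exists[OF N a(1) this] obtain \<psi>0 where
        r: "pi / 2 < (N + 1) * \<psi>0" "N * \<psi>0 < pi / 2" "a = tan_cot N \<psi>0" by blast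
      define b'' where "b'' = - cot (N * \<psi>0) * tan ((N + 1) * \<psi>0)"
      note p = C_even_point[OF N r(1,2), folded r(3) b''_def]
      have "(a, b'') \<in> C_even n" unfolding C_even_iff[OF n] N_def[symmetric] using r b''_def by blast
      then have "b \<le> b''" by (rule even)
      moreover have "(Q \<psi>0)\<^sup>2 = 1 - (1 - a) * (b'' / (a + b''))"
        unfolding Q_def by (rule curve_identity) (use p r sin_ratio_pos[OF N p(1,2)] in auto)
      ultimately have "Q \<psi>0 \<le> q"
        using mass_ratio_le_iff[OF a b p(4) q(1) Q_pos[OF p(1,2)] q(2)] by blast
      then show ?thesis using p r by auto
    next
      case False
      note e = C_even_endpoint[OF N]
      have "(tan (pi / (2 * (N + 1))))\<^sup>2 \<le> q\<^sup>2" using False gt_a q(2) by linarith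
      then have "tan (pi / (2 * (N + 1))) \<le> q" using e(5) q(1) by (simp add: power2_le_iff_abs_le)
      then show ?thesis using e(1-4) False unfolding Q_def
        by (intro exI[of _ "pi / (2 * (N + 1))"]) auto
    qed
    then obtain \<psi>0 where 0: "0 < \<psi>0" "N * \<psi>0 < pi / 2" "Q \<psi>0 \<le> q" "tan_cot N \<psi>0 \<le> a" by blast
    have "N * \<psi>0 \<le> N * \<psi>1" using 0 1 by linarith
    then have le: "\<psi>0 \<le> \<psi>1" using N by simp
    have between: "0 < t \<and> N * t < pi" if "\<psi>0 \<le> t" "t \<le> \<psi>1" for t
    proof -
      have "N * t \<le> N * \<psi>1" using that N by simp
      then show ?thesis using that 0 1 by linarith
    qed
    have "continuous_on {\<psi>0..\<psi>1} Q" unfolding Q_def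
      using between sin_ratio_pos(2)[OF N] by (force intro!: continuous_intros)
    then obtain \<psi> where \<psi>: "\<psi>0 \<le> \<psi>" "\<psi> \<le> \<psi>1" "Q \<psi> = q"
      using IVT'[of Q \<psi>0 q \<psi>1] 0(3) q1 le by blast
    note r = between[OF \<psi>(1,2)]
    have "tan_cot N \<psi> \<le> tan_cot N \<psi>0" "tan_cot N \<psi>1 \<le> tan_cot N \<psi>"
      using T_le between[of \<psi>0] between[of \<psi>1] r \<psi> le by auto
    then have "\<bar>tan_cot N \<psi>\<bar> \<le> a" using 0(4) 1(5) by linarith
    then show "\<exists>\<psi>. capture_angle N a b \<psi>" unfolding cap using r \<psi>(3) q(2) by blast
  qed
qed

text \<open>The reduction to \<open>tan_cot\<close> relies on \<open>1 - a > 0\<close> and is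
  replaced by a case distinction. \<open>C_even\<close> stays within \<open>a < 1\<close>, so its
  clause is vacuous. For \<open>n \<ge> 2\<close> both sides fail: \<open>C_odd\<close> also stays
  within \<open>a < 1\<close>, and the sine quotient is below 1 while the energy equation demands at
  least 1. For \<open>n = 1\<close> both sides reduce to \<open>a \<le> b\<close>.\<close>

lemma capture_angle_iff_between_curves_ge_1:
  assumes a: "a \<ge> 1" and b: "0 < b" and n: "n \<ge> 1"
  shows "(\<exists>\<psi>. capture_angle (2 * real n) a b \<psi>) \<longleftrightarrow>
    (\<exists>b'. b' \<le> b \<and> (a, b') \<in> C_odd n) \<and> (\<forall>b''. (a, b'') \<in> C_even n \<longrightarrow> b \<le> b'')"
proof -
  have N: "2 * real n \<ge> 2" using n by simp
  have no_even: "(a, b'') \<notin> C_even n" for b''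
  proof
    assume "(a, b'') \<in> C_even n"
    then obtain \<psi> where \<psi>: "pi / 2 < (2 * real n + 1) * \<psi>" "(2 * real n) * \<psi> < pi / 2"
      "a = tan_cot (2 * real n) \<psi>" by (rule C_even_energy[OF n])
    note e = C_even_endpoint[OF N]
    have "pi / (2 * (2 * real n + 1)) < \<psi>" using \<psi>(1) by (simp add: field_simps)
    moreover have "2 * real n * \<psi> < pi" using \<psi>(2) pi_gt_zero by linarith
    ultimately have "a < (tan (pi / (2 * (2 * real n + 1))))\<^sup>2"
      unfolding \<psi>(3) e(4)[symmetric] by (intro tan_cot_strict_antimono N e(1))
    then show False using e(6) a by linarith
  qed
  have energy_ge: "1 - (1 - a) * (b / (a + b)) \<ge> 1"
  proof -
    have "(1 - a) * (b / (a + b)) \<le> 0" using a b by (intro mult_nonpos_nonneg) auto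
    then show ?thesis by simp
  qed
  show ?thesis
  proof (cases "n = 1")
    case False
    then have N4: "2 * real n \<ge> 4" "2 * real n > 2" using n by auto
    note e = C_odd_endpoint[OF N4(2)] and t = tan_C_odd_endpoint[OF N4(1)]
    have "\<not> capture_angle (2 * real n) a b \<psi>" for \<psi>
    proof
      assume c: "capture_angle (2 * real n) a b \<psi>"
      have \<psi>: "0 < \<psi>" "2 * real n * \<psi> < pi" using c by (auto simp: capture_angle_def)
      have "(2 * real n - 1) * \<psi> < pi / 2"
        by (rule capture_angle_bound[OF _ b N c]) (use a in simp)
      then have "\<psi> < pi / (2 * (2 * real n - 1))" using N4 by (simp add: field_simps)
      then have "sin \<psi> / sin (2 * real n * \<psi>) < tan (pi / (2 * (2 * real n - 1)))"
        unfolding e(3)[symmetric] using \<psi> N e(2) by (intro sin_ratio_strict_mono) auto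
      then have "sin \<psi> / sin (2 * real n * \<psi>) < 1" using t by simp
      then have "(sin \<psi> / sin (2 * real n * \<psi>))\<^sup>2 < 1"
        using sin_ratio_pos(1)[OF N \<psi>] by (simp only: abs_square_less_1 abs_of_pos)
      then show False using c energy_ge by (simp add: capture_angle_def)
    qed
    moreover have "(a, b') \<notin> C_odd n" for b'
    proof
      assume "(a, b') \<in> C_odd n"
      then obtain \<psi> where \<psi>: "(2 * real n - 1) * \<psi> < pi / 2" "0 < \<psi>" "a = - tan_cot (2 * real n) \<psi>"
        by (rule C_odd_energy[OF n])
      have "\<psi> < pi / (2 * (2 * real n - 1))" using N4 \<psi>(1) by (simp add: field_simps)
      then have "- (tan (pi / (2 * (2 * real n - 1))))\<^sup>2 < tan_cot (2 * real n) \<psi>"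
        unfolding e(4)[symmetric] by (intro tan_cot_strict_antimono N \<psi>(2) e(2))
      moreover have "(tan (pi / (2 * (2 * real n - 1))))\<^sup>2 < 1" using t by (simp add: abs_square_less_1)
      ultimately show False using a \<psi>(3) by linarith
    qed
    ultimately show ?thesis by blast
  next
    case True
    \<comment> \<open>The double angle formula makes the scattering expression constant, so the
      upper bound turns into \<open>a \<le> b\<close>.\<close>
    have F: "cos \<psi> * sin ((2 * real n - 1) * \<psi>) / sin (2 * real n * \<psi>) = 1 / 2"
        "sin \<psi> / sin (2 * real n * \<psi>) = 1 / (2 * cos \<psi>)" if "0 < \<psi>" "\<psi> < pi / 2" for \<psi>
    proof -
      have "sin \<psi> > 0" "cos \<psi> > 0" using that by (auto intro!: sin_gt_zero cos_gt_zero)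
      then show "cos \<psi> * sin ((2 * real n - 1) * \<psi>) / sin (2 * real n * \<psi>) = 1 / 2"
        "sin \<psi> / sin (2 * real n * \<psi>) = 1 / (2 * cos \<psi>)"
        using True by (simp_all add: sin_double)
    qed
    have half: "1 / 2 \<le> b / (a + b) \<longleftrightarrow> a \<le> b" using a b by (simp add: field_simps)
    have "(\<exists>\<psi>. capture_angle (2 * real n) a b \<psi>) \<longleftrightarrow> a \<le> b"
    proof
      assume "\<exists>\<psi>. capture_angle (2 * real n) a b \<psi>"
      then obtain \<psi> where c: "capture_angle (2 * real n) a b \<psi>" by blast
      then have "\<psi> < pi / 2" "0 < \<psi>" using True by (auto simp: capture_angle_def)
      then show "a \<le> b" using c F half by (simp add: capture_angle_def)
    next
      assume ab: "a \<le> b"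
      define L where "L = 1 - (1 - a) * (b / (a + b))"
      have L: "L \<ge> 1" using energy_ge by (simp add: L_def)
      \<comment> \<open>Chosen so that \<open>1 / (2 * c)\<close>, the sine quotient for
        \<open>cos \<psi> = c\<close>, has square \<open>L\<close>.\<close>
      define c where "c = 1 / (2 * sqrt L)"
      have "sqrt L \<ge> 1" using L by simp
      then have "2 * sqrt L > 1" by linarith
      then have c: "0 < c" "c < 1" "1 / (2 * c) = sqrt L" using L by (simp_all add: c_def)
      define \<psi> where "\<psi> = arccos c"
      have \<psi>: "0 < \<psi>" "\<psi> < pi / 2" "cos \<psi> = c"
        using arccos_lt_bounded[of c] arccos_less_mono[of c 0] c by (auto simp: \<psi>_def)
      have "(1 - a) / (1 + a) * (b / (a + b)) \<le> 0"
        using a b by (intro mult_nonpos_nonneg divide_nonpos_nonneg) auto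
      then have "(1 - a) / (1 + a) * (b / (a + b)) \<le> 1 / 2" by linarith
      then have "capture_angle (2 * real n) a b \<psi>"
        unfolding capture_angle_def F[OF \<psi>(1,2)] unfolding \<psi>(3) c(3) L_def[symmetric]
        using True \<psi>(1,2) L iffD2[OF half ab] by (intro conjI) (simp_all only:, simp_all)
      then show "\<exists>\<psi>. capture_angle (2 * real n) a b \<psi>" ..
    qed
    moreover have "(\<exists>b'. b' \<le> b \<and> (a, b') \<in> C_odd n) \<longleftrightarrow> a \<le> b"
    proof -
      have "\<exists>\<psi>. pi / 2 < (2 * real n) * \<psi> \<and> (2 * real n - 1) * \<psi> < pi / 2 \<and> a = - tan_cot (2 * real n) \<psi>"
        by (rule C_odd_parameter_exists[OF N]) (use a True in auto)
      \<comment> \<open>With \<open>N = 2\<close> the multiple \<open>(N - 1) * \<psi>\<close> is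
        \<open>\<psi>\<close> itself, so both coordinates coincide and the curve is the
        diagonal.\<close>
      then have "(a, a) \<in> C_odd n" unfolding C_odd_iff[OF n] using True by (auto simp: tan_cot_def)
      moreover have "b' = a" if "(a, b') \<in> C_odd n" for b'
        using that True unfolding C_odd_iff[OF n] by (auto simp: tan_cot_def)
      ultimately show ?thesis by blast
    qed
    ultimately show ?thesis using no_even by blast
  qed
qed

theorem mainTheorem1:
  fixes m :: "particle \<Rightarrow> real" and a b :: real and n :: nat
  assumes "m P1 > 0" "m P2 > 0" "m P3 > 0"
    and "a = m P1 / m P2" "b = m P3 / m P2"
    and "n \<ge> 1"
  shows "capture_allowed m (seq32 n) \<longleftrightarrow>
    (\<exists>b'. b' \<le> b \<and> (a, b') \<in> C_odd n) \<and> (\<forall>b''. (a, b'') \<in> C_even n \<longrightarrow> b \<le> b'')"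
proof -
  have m: "m i > 0" for i using assms(1-3) by (cases i) auto
  have ab: "a > 0" "b > 0" using assms by simp_all
  define \<alpha> where "\<alpha> = m P2 / (m P1 + m P2)"
  define \<beta> where "\<beta> = m P3 / (m P1 + m P3)"
  have rng: "0 < \<alpha>" "\<alpha> < 1" "0 < \<beta>" "\<beta> < 1" using assms(1-3) by (simp_all add: \<alpha>_def \<beta>_def)
  have \<beta>: "\<beta> = b / (a + b)" using assms by (simp add: \<beta>_def add_divide_distrib[symmetric])
  have \<alpha>: "\<alpha> = 1 / (1 + a)" using assms(1,2) unfolding assms(4) \<alpha>_def by (simp add: field_simps)
  have \<alpha>': "2 * \<alpha> - 1 = (1 - a) / (1 + a)" using ab unfolding \<alpha> by (simp add: field_simps)
  \<comment> \<open>The denominator \<open>1 + a\<close> of \<open>2 * \<alpha> - 1\<close> cancels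
    against \<open>\<alpha>\<close>, so the energy equation involves only \<open>1 - a\<close> and
    \<open>\<beta>\<close>.\<close>
  have "(2 * \<alpha> - 1) * \<beta> / \<alpha> = (1 - a) * \<beta>"
    unfolding \<alpha>' unfolding \<alpha> using ab by simp
  then have "capture_allowed m (seq32 n) \<longleftrightarrow> (\<exists>\<psi>. capture_angle (2 * real n) a b \<psi>)"
    unfolding capture_allowed_iff_steerable[OF m assms(6) \<alpha>_def \<beta>_def]
      steerable_after_first_iff[OF rng assms(6)] capture_angle_def \<beta>[symmetric] \<alpha>' by simp
  also have "\<dots> \<longleftrightarrow>
      (\<exists>b'. b' \<le> b \<and> (a, b') \<in> C_odd n) \<and> (\<forall>b''. (a, b'') \<in> C_even n \<longrightarrow> b \<le> b'')"
    using capture_angle_iff_between_curves_less_1[OF ab(1) _ ab(2) assms(6)]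
      capture_angle_iff_between_curves_ge_1[OF _ ab(2) assms(6)] by (cases "a < 1") auto
  finally show ?thesis .
qed

end
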